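(* Let $X=\{X_t\}_{t\ge 0}$ be a critical CB process with branching mechanism $\psi$ satisfying $\psi'(0+)=0$ and $\int_{\theta_0}^{+\infty}\frac{d\xi}{\psi(\xi)}<+\infty$ for some $\theta_0>0$. Suppose that $\psi(\lambda)=\lambda L(1/\lambda)$ for all $\lambda>0$, where $L$ is slowly varying at $+\infty$. Let $$V(x):=\int_{1/x}^{+\infty}\frac{1}{\psi(\xi)}\,d\xi=\int_0^x\frac{1}{\xi L(\xi)}\,d\xi,\quad x>0.$$ Then $$V(\bar F(t)^{-1})\sim t\quad\text{as } t\uparrow+\infty,$$ and $$\lim_{t\to+\infty}P_x\left(L(\bar F(t)^{-1})\,V(X_t)\le y\,\middle|\,\tau>t\right)=1-e^{-y}$$ for any $x>0$ and $y\ge 0$.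
   Context: A (conservative) continuous-state branching process (CB process) is a $[0,+\infty)$-valued strong Markov process $X=\{X_t:t\ge 0\}$ with probabilities $\{P_x:x>0\}$ ($X$ starts at $x$ under $P_x$), with right-continuous paths having left limits, satisfying the branching property $E_{x+y}(e^{-\lambda X_t})=E_x(e^{-\lambda X_t})E_y(e^{-\lambda X_t})$ for all $\lambda,t\ge 0$, $x,y>0$. It is characterized by its branching mechanism $$\psi(\lambda)=a\lambda+b\lambda^2+\int_{(0,+\infty)}(e^{-\lambda x}-1+\lambda x)\,\Lambda(dx),\quad \lambda\ge 0,$$ with $a\in\mathbb R$, $b\ge 0$, and $\Lambda$ (the L\'evy measure of $\psi$) a non-negative measure on $(0,+\infty)$ with $\int_{(0,+\infty)}(x^2\wedge x)\Lambda(dx)<+\infty$, in the sense that $E_x(e^{-\lambda X_t})=e^{-x u_t(\lambda)}$, where $u_t(\lambda)$ is the unique positive solution of $\frac{\partial}{\partial t}u_t(\lambda)=-\psi(u_t(\lambda))$, $u_0(\lambda)=\lambda$. The process is called critical if $\psi'(0+)=0$. $\tau:=\inf\{t\ge 0:X_t=0\}$ is the extinction time (so $\{\tau>t\}=\{X_t>0\}$ almost surely), and $\bar F(t):=P_1(\tau>t)$. By convention $V(0)=0$. A positive measurable function $L$ on $(0,+\infty)$ is slowly varying at $+\infty$ if $\lim_{x\to+\infty}L(\lambda x)/L(x)=1$ for all $\lambda>0$. The notation $f(t)\sim g(t)$ means $f(t)/g(t)\to 1$. *)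

theory Defs
  imports "HOL-Probability.Probability" "HOL-Library.Landau_Symbols"
begin

definition levy_measure :: "real measure \<Rightarrow> bool" where
  "levy_measure \<Lambda> \<longleftrightarrow>
     sets \<Lambda> = sets (restrict_space borel {0<..}) \<and>
     (\<integral>\<^sup>+x. ennreal (min (x\<^sup>2) x) \<partial>\<Lambda>) < \<infinity>"

definition branching_mechanism :: "(real \<Rightarrow> real) \<Rightarrow> bool" where
  "branching_mechanism \<psi> \<longleftrightarrow>
     (\<exists>a b \<Lambda>. 0 \<le> b \<and> levy_measure \<Lambda> \<and>
        (\<forall>l\<ge>0. \<psi> l = a * l + b * l\<^sup>2 + (\<integral>x. (exp (- l * x) - 1 + l * x) \<partial>\<Lambda>)))"

text \<open>\<open>\<psi>'(0+)\<close> is read as the right derivative at \<open>0\<close>. Only values of \<open>\<psi>\<close> on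
  \<open>[0, \<infinity>)\<close> are used.\<close>

definition critical :: "(real \<Rightarrow> real) \<Rightarrow> bool" where
  "critical \<psi> \<longleftrightarrow> (\<psi> has_real_derivative 0) (at_right 0)"

definition positive_cumulant :: "(real \<Rightarrow> real) \<Rightarrow> real \<Rightarrow> (real \<Rightarrow> real) \<Rightarrow> bool" where
  "positive_cumulant \<psi> l u \<longleftrightarrow>
     u 0 = l \<and>
     (\<forall>t\<ge>0. 0 < u t \<and> (u has_real_derivative - \<psi> (u t)) (at t within {0..}))"

text \<open>The time index is \<open>ennreal\<close>, so that stopping times may be infinite.\<close>

definition natural_filtration ::
    "'w measure \<Rightarrow> (real \<Rightarrow> 'w \<Rightarrow> real) \<Rightarrow> ennreal \<Rightarrow> 'w measure" where
  "natural_filtration M X t =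
     sigma (space M)
       {X s -` B \<inter> space M | s B. 0 \<le> s \<and> ennreal s \<le> t \<and> B \<in> sets borel}"

lemma filtration_natural_filtration:
  "filtration (space M) (natural_filtration M X)"
proof
  have sub: "{X s -` B \<inter> space M | s B. 0 \<le> s \<and> ennreal s \<le> t \<and> B \<in> sets borel}
      \<subseteq> Pow (space M)" for t
    by auto
  show "space (natural_filtration M X t) = space M" for t
    unfolding natural_filtration_def by (rule space_measure_of[OF sub])
  show "sets (natural_filtration M X s) \<subseteq> sets (natural_filtration M X t)"
    if "s \<le> t" for s t
    unfolding natural_filtration_def sets_measure_of[OF sub]
    using that by (intro sigma_sets_mono') (auto intro: order_trans)
qed

text \<open>The laws are indexed by starting points \<open>x > 0\<close>; the state \<open>0\<close> is absorbing,
  in accordance with \<open>exp (- x * u\<^sub>t l) = 1\<close> for \<open>x = 0\<close>.\<close>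

definition transition ::
    "(real \<Rightarrow> 'w measure) \<Rightarrow> (real \<Rightarrow> 'w \<Rightarrow> real) \<Rightarrow> real \<Rightarrow> real \<Rightarrow> real measure" where
  "transition P X t y = (if y = 0 then return borel 0 else distr (P y) borel (X t))"

locale cb_process =
  fixes M :: "'w measure"
    and P :: "real \<Rightarrow> 'w measure"
    and X :: "real \<Rightarrow> 'w \<Rightarrow> real"
    and \<psi> :: "real \<Rightarrow> real"
  assumes prob_space_P: "\<And>x. 0 < x \<Longrightarrow> prob_space (P x)"
    and sets_P: "\<And>x. 0 < x \<Longrightarrow> sets (P x) = sets M"
    and measurable_X: "\<And>t. 0 \<le> t \<Longrightarrow> X t \<in> borel_measurable M"
    and X_nonneg: "\<And>t \<omega>. 0 \<le> t \<Longrightarrow> \<omega> \<in> space M \<Longrightarrow> 0 \<le> X t \<omega>"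
    and X_start: "\<And>x. 0 < x \<Longrightarrow> AE \<omega> in P x. X 0 \<omega> = x"
    and X_right_continuous:
      "\<And>t \<omega>. 0 \<le> t \<Longrightarrow> \<omega> \<in> space M \<Longrightarrow> continuous (at_right t) (\<lambda>s. X s \<omega>)"
    and X_left_limits:
      "\<And>t \<omega>. 0 < t \<Longrightarrow> \<omega> \<in> space M \<Longrightarrow> \<exists>l. ((\<lambda>s. X s \<omega>) \<longlongrightarrow> l) (at_left t)"
    and transition_kernel:
      "\<And>t. 0 \<le> t \<Longrightarrow>
         transition P X t \<in> restrict_space borel {0..} \<rightarrow>\<^sub>M prob_algebra borel"
    and strong_markov:
      "\<And>x t T A B. 0 < x \<Longrightarrow> 0 \<le> t \<Longrightarrow>
         stopping_time (natural_filtration M X) T \<Longrightarrow>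
         A \<in> sets (filtration.pre_sigma (space M) (natural_filtration M X) T) \<Longrightarrow>
         B \<in> sets borel \<Longrightarrow>
         measure (P x) {\<omega> \<in> A. T \<omega> < \<infinity> \<and> X (enn2real (T \<omega>) + t) \<omega> \<in> B} =
         (\<integral>\<omega>. indicator {\<omega> \<in> A. T \<omega> < \<infinity>} \<omega> *
               measure (transition P X t (X (enn2real (T \<omega>)) \<omega>)) B \<partial>P x)"
    and branching:
      "\<And>x y l t. 0 < x \<Longrightarrow> 0 < y \<Longrightarrow> 0 \<le> l \<Longrightarrow> 0 \<le> t \<Longrightarrow>
         (\<integral>\<omega>. exp (- l * X t \<omega>) \<partial>P (x + y)) =
         (\<integral>\<omega>. exp (- l * X t \<omega>) \<partial>P x) * (\<integral>\<omega>. exp (- l * X t \<omega>) \<partial>P y)"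
    and mechanism: "branching_mechanism \<psi>"
    and laplace:
      "\<And>l. 0 < l \<Longrightarrow>
         \<exists>u. positive_cumulant \<psi> l u \<and>
             (\<forall>x>0. \<forall>t\<ge>0. (\<integral>\<omega>. exp (- l * X t \<omega>) \<partial>P x) = exp (- x * u t))"

definition extinction_time :: "(real \<Rightarrow> 'w \<Rightarrow> real) \<Rightarrow> 'w \<Rightarrow> ennreal" where
  "extinction_time X \<omega> = Inf {ennreal t | t. 0 \<le> t \<and> X t \<omega> = 0}"

text \<open>As a hitting time of a closed set, the extinction time need not be measurable before
  completion, so events about it are measured by the completed laws.\<close>

definition survival :: "(real \<Rightarrow> 'w measure) \<Rightarrow> (real \<Rightarrow> 'w \<Rightarrow> real) \<Rightarrow> real \<Rightarrow> real" where
  "survival P X t = \<P>(\<omega> in completion (P 1). ennreal t < extinction_time X \<omega>)"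

definition slowly_varying :: "(real \<Rightarrow> real) \<Rightarrow> bool" where
  "slowly_varying L \<longleftrightarrow>
     L \<in> borel_measurable (restrict_space borel {0<..}) \<and>
     (\<forall>x>0. 0 < L x) \<and>
     (\<forall>c>0. ((\<lambda>x. L (c * x) / L x) \<longlongrightarrow> 1) at_top)"

definition V_of :: "(real \<Rightarrow> real) \<Rightarrow> real \<Rightarrow> real" where
  "V_of \<psi> x = (if x = 0 then 0 else (LINT \<xi>:{1 / x..}|lborel. 1 / \<psi> \<xi>))"

end

theory Submission
  imports Defs
begin

text \<open>
  Write \<open>g l\<close> for the integral of \<open>1 / \<psi>\<close> over \<open>[l, \<infinity>)\<close>, so that \<open>V x = g (1 / x)\<close>. The differential
  equation gives \<open>g (u\<^sub>t l) = t + g l\<close>, and letting \<open>l \<rightarrow> \<infinity>\<close> shows \<open>P\<^sub>x (\<tau> \<le> t) = exp (- x v\<^sub>t)\<close> with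
  \<open>g v\<^sub>t = t\<close>. By convexity \<open>\<psi> l / l = L (1 / l)\<close> is monotone, whence
  \<open>ln (b / a) / L (1 / b) \<le> g a - g b \<le> ln (b / a) / L (1 / a)\<close> for \<open>a \<le> b\<close>. These bounds make
  \<open>g\<close> slowly varying at \<open>0\<close>, and \<open>V (1 / F t) ~ t\<close> follows because
  \<open>F t = P\<^sub>1 (\<tau> > t) = 1 - exp (- v\<^sub>t) ~ v\<^sub>t\<close>. If moreover \<open>q\<^sub>y\<close> is
  chosen with \<open>g q\<^sub>y = y / L (1 / F t)\<close>, they give \<open>u\<^sub>t q\<^sub>y / v\<^sub>t \<rightarrow> exp (- y)\<close>, so the conditional Laplace
  transform of \<open>X\<^sub>t\<close> at \<open>q\<^sub>y\<close> tends to \<open>1 - exp (- y)\<close>. The ratio of \<open>q\<^sub>y\<close> to \<open>q\<^sub>z\<close> tends to infinity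
  whenever \<open>y < z\<close>, so the indicator of \<open>X\<^sub>t \<le> 1 / q\<^sub>y\<close>, that is of \<open>L (1 / F t) V (X\<^sub>t) \<le> y\<close>, is squeezed
  between exponentials with parameters slightly to either side of \<open>y\<close>.
\<close>

section \<open>Branching mechanisms\<close>

text \<open>With \<open>z = l * x\<close> the integrand is nonnegative and bounded by both
  \<open>z\<close> and \<open>z\<^sup>2\<close>, hence by a multiple of
  \<open>min (x\<^sup>2) x\<close>, which a Levy measure integrates.\<close>

lemma levy_integrable:
  assumes "levy_measure \<Lambda>" "0 \<le> l"
  shows "integrable \<Lambda> (\<lambda>x. exp (- l * x) - 1 + l * x)"
proof -
  have sets: "sets \<Lambda> = sets (restrict_space borel {0<..})"
    and fin: "(\<integral>\<^sup>+x. ennreal (min (x\<^sup>2) x) \<partial>\<Lambda>) < \<infinity>"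
    using assms(1) by (auto simp: levy_measure_def)
  have space: "space \<Lambda> = {0<..}"
    using sets_eq_imp_space_eq[OF sets] by (simp add: space_restrict_space)
  have meas: "f \<in> borel_measurable \<Lambda>" if "f \<in> borel_measurable borel" for f :: "real \<Rightarrow> real"
    using that sets by (subst measurable_cong_sets[OF sets refl]) (rule measurable_restrict_space1)
  have "integrable \<Lambda> (\<lambda>x. (l + l\<^sup>2) * min (x\<^sup>2) x)"
    using fin by (intro integrable_mult_right integrableI_nonneg meas AE_I2) (auto simp: space)
  then show ?thesis
  proof (rule Bochner_Integration.integrable_bound)
    show "(\<lambda>x. exp (- l * x) - 1 + l * x) \<in> borel_measurable \<Lambda>"
      by (rule meas) measurable
    show "AE x in \<Lambda>. norm (exp (- l * x) - 1 + l * x) \<le> norm ((l + l\<^sup>2) * min (x\<^sup>2) x)"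
    proof (rule AE_I2)
      fix x assume "x \<in> space \<Lambda>"
      then have x: "0 < x" by (simp add: space)
      define z where "z = l * x"
      have z: "0 \<le> z" using x assms(2) by (simp add: z_def)
      have lo: "0 \<le> exp (-z) - 1 + z" using exp_ge_add_one_self[of "-z"] by linarith
      have hi1: "exp (-z) - 1 + z \<le> z" using z by simp
      have hi2: "exp (-z) - 1 + z \<le> z\<^sup>2"
      proof (cases "z \<le> 1")
        case True
        have "exp (-z) * (1 + z) \<le> exp (-z) * exp z"
          by (intro mult_left_mono exp_ge_add_one_self) auto
        then have "exp (-z) \<le> 1 / (1 + z)" using z by (simp add: exp_minus field_simps)
        \<comment> \<open>The product of \<open>1 + z\<close> and \<open>1 - z + z\<^sup>2\<close>
          is \<open>1 + z ^ 3\<close>, which is at least 1.\<close>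
        also have "\<dots> \<le> 1 - z + z\<^sup>2" using z
          by (simp add: field_simps power2_eq_square)
        finally show ?thesis by simp
      next
        case False
        then have "z \<le> z\<^sup>2" by (simp add: power2_eq_square)
        with hi1 show ?thesis by linarith
      qed
      have "exp (-z) - 1 + z \<le> (l + l\<^sup>2) * min (x\<^sup>2) x"
      proof (cases "x\<^sup>2 \<le> x")
        case True
        have "z\<^sup>2 \<le> (l + l\<^sup>2) * x\<^sup>2" using assms(2) by (simp add: z_def power_mult_distrib distrib_right)
        with True hi2 show ?thesis by simp
      next
        case False
        have "z \<le> (l + l\<^sup>2) * x" using assms(2) x by (simp add: z_def distrib_right)
        with False order_trans[OF hi1] show ?thesis by simp
      qed
      with lo show "norm (exp (- l * x) - 1 + l * x) \<le> norm ((l + l\<^sup>2) * min (x\<^sup>2) x)"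
        by (simp add: z_def)
    qed
  qed
qed

lemma branching_mechanism_0: "branching_mechanism \<psi> \<Longrightarrow> \<psi> 0 = 0"
  unfolding branching_mechanism_def by fastforce

text \<open>For a fixed jump size the integrand is an exponential plus an affine function of
  \<open>l\<close>, hence convex in \<open>l\<close>, and integration preserves this. The linear
  term may have either sign; the quadratic one is convex because \<open>0 \<le> b\<close>.\<close>

lemma convex_on_branching_mechanism:
  assumes "branching_mechanism \<psi>"
  shows "convex_on {0..} \<psi>"
proof -
  obtain a b \<Lambda> where b: "0 \<le> b" and levy: "levy_measure \<Lambda>"
    and \<psi>: "\<And>l. 0 \<le> l \<Longrightarrow> \<psi> l = a * l + b * l\<^sup>2 + (\<integral>x. (exp (- l * x) - 1 + l * x) \<partial>\<Lambda>)"
    using assms unfolding branching_mechanism_def by auto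
  show ?thesis
  proof (rule convex_onI)
    fix t x y :: real
    assume t: "0 < t" "t < 1" and "x \<in> {0..}" "y \<in> {0..}"
    then have x: "0 \<le> x" and y: "0 \<le> y" by auto
    define m where "m = (1 - t) * x + t * y"
    have m: "0 \<le> m" unfolding m_def using t x y by simp
    have int: "(\<integral>z. (exp (- m * z) - 1 + m * z) \<partial>\<Lambda>)
        \<le> (\<integral>z. (1 - t) * (exp (- x * z) - 1 + x * z) + t * (exp (- y * z) - 1 + y * z) \<partial>\<Lambda>)"
    proof (rule integral_mono)
      fix z
      have "exp ((1 - t) * (- x * z) + t * (- y * z)) \<le> (1 - t) * exp (- x * z) + t * exp (- y * z)"
        using convex_onD[OF exp_convex, of t "- x * z" "- y * z"] t by simp
      moreover have "(1 - t) * (- x * z) + t * (- y * z) = - m * z"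
        by (simp add: m_def algebra_simps)
      ultimately have "exp (- m * z) \<le> (1 - t) * exp (- x * z) + t * exp (- y * z)" by simp
      then show "exp (- m * z) - 1 + m * z
          \<le> (1 - t) * (exp (- x * z) - 1 + x * z) + t * (exp (- y * z) - 1 + y * z)"
        by (simp add: m_def algebra_simps)
    qed (intro levy_integrable levy m x y Bochner_Integration.integrable_add integrable_mult_right)+
    have "m\<^sup>2 \<le> (1 - t) * x\<^sup>2 + t * y\<^sup>2"
      using convex_onD[OF convex_power2, of t x y] t by (simp add: m_def)
    then have sq: "b * m\<^sup>2 \<le> b * ((1 - t) * x\<^sup>2 + t * y\<^sup>2)"
      using b by (rule mult_left_mono)
    have "\<psi> m \<le> (1 - t) * \<psi> x + t * \<psi> y"
    proof -
      define I where "I l = (\<integral>z. (exp (- l * z) - 1 + l * z) \<partial>\<Lambda>)" for l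
      have "I m \<le> (1 - t) * I x + t * I y"
        using int levy_integrable[OF levy x] levy_integrable[OF levy y] unfolding I_def by simp
      then show ?thesis
        using sq unfolding \<psi>[OF m] \<psi>[OF x] \<psi>[OF y] I_def[symmetric]
        by (simp add: m_def algebra_simps)
    qed
    then show "\<psi> ((1 - t) *\<^sub>R x + t *\<^sub>R y) \<le> (1 - t) * \<psi> x + t * \<psi> y"
      by (simp add: m_def)
  qed simp
qed

text \<open>\<open>a\<close> is the mean of 0 and \<open>b\<close> with weights
  \<open>1 - a / b\<close> and \<open>a / b\<close>, and \<open>f\<close> vanishes at 0. Applied to
  \<psi>, this is the monotonicity behind the logarithmic bounds on \<open>tail\<close>.\<close>

lemma convex_on_slope_mono:
  fixes f :: "real \<Rightarrow> real"
  assumes "convex_on {0..} f" "f 0 = 0" "0 < a" "a \<le> b"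
  shows "f a / a \<le> f b / b"
proof -
  have "f ((1 - a / b) *\<^sub>R 0 + (a / b) *\<^sub>R b) \<le> (1 - a / b) * f 0 + (a / b) * f b"
    using assms by (intro convex_onD[OF assms(1)]) auto
  then show ?thesis using assms by (simp add: field_simps)
qed

section \<open>The tail integral of the reciprocal mechanism\<close>

text \<open>The quotient is a difference quotient at 0. It lets \<open>1 - exp (- w)\<close> be
  replaced by \<open>w\<close>, both in the survival probability and in the conditional Laplace
  transform.\<close>

lemma one_minus_exp_over_self: "((\<lambda>w::real. (1 - exp (- w)) / w) \<longlongrightarrow> 1) (at_right 0)"
proof -
  have "((\<lambda>w::real. 1 - exp (- w)) has_real_derivative 1) (at 0)"
    by (auto intro!: derivative_eq_intros)
  then have "((\<lambda>w::real. (1 - exp (- w)) / w) \<longlongrightarrow> 1) (at 0)"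
    by (simp add: DERIV_def)
  then show ?thesis by (rule tendsto_mono[OF at_le, rotated]) simp
qed

text \<open>The analytic facts about \<psi> are kept apart from the process. \<open>slope_0\<close>
  is criticality, \<open>slope_var\<close> is slow variation of \<open>L\<close> read at
  \<open>1 / l\<close>, and \<open>tail_integrable\<close> is Grey's condition extended to every
  positive lower limit.\<close>

locale grey_mechanism =
  fixes \<psi> :: "real \<Rightarrow> real"
  assumes cont: "continuous_on {0<..} \<psi>"
    and pos: "0 < l \<Longrightarrow> 0 < \<psi> l"
    and slope_mono: "0 < a \<Longrightarrow> a \<le> b \<Longrightarrow> \<psi> a / a \<le> \<psi> b / b"
    and slope_0: "((\<lambda>l. \<psi> l / l) \<longlongrightarrow> 0) (at_right 0)"
    and slope_var: "0 < c \<Longrightarrow> ((\<lambda>l. (\<psi> (c * l) / (c * l)) / (\<psi> l / l)) \<longlongrightarrow> 1) (at_right 0)"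
    and tail_integrable: "0 < l \<Longrightarrow> set_integrable lborel {l..} (\<lambda>\<xi>. 1 / \<psi> \<xi>)"
begin

text \<open>In the setting of the theorem this is \<open>L (1 / l)\<close>.\<close>

definition slope :: "real \<Rightarrow> real" where "slope l = \<psi> l / l"

text \<open>This is the function \<open>g\<close> of the overview.\<close>

definition tail :: "real \<Rightarrow> real" where
  "tail l = (LINT \<xi>:{l..}|lborel. 1 / \<psi> \<xi>)"

lemma slope_pos: "0 < l \<Longrightarrow> 0 < slope l"
  using pos by (simp add: slope_def)

lemma isCont_mechanism: "0 < l \<Longrightarrow> isCont \<psi> l"
  using cont by (simp add: continuous_on_eq_continuous_at)

lemma tail_split:
  assumes "0 < a" "a \<le> b"
  shows "tail a = integral {a..b} (\<lambda>\<xi>. 1 / \<psi> \<xi>) + tail b"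
proof -
  have "{a..} = {a..b} \<union> {b<..}" using assms by auto
  moreover have "(LINT \<xi>:{a..b} \<union> {b<..}|lborel. 1 / \<psi> \<xi>)
      = (LINT \<xi>:{a..b}|lborel. 1 / \<psi> \<xi>) + (LINT \<xi>:{b<..}|lborel. 1 / \<psi> \<xi>)"
    using assms by (intro set_integral_Un set_integrable_subset[OF tail_integrable[of a]]) auto
  moreover have "(LINT \<xi>:{b<..}|lborel. 1 / \<psi> \<xi>) = tail b"
    unfolding tail_def set_lebesgue_integral_def
    by (rule integral_discrete_difference[where X = "{b}"]) (auto simp: indicator_def)
  moreover have "(LINT \<xi>:{a..b}|lborel. 1 / \<psi> \<xi>) = integral {a..b} (\<lambda>\<xi>. 1 / \<psi> \<xi>)"
    using assms
    by (intro set_borel_integral_eq_integral set_integrable_subset[OF tail_integrable[of a]]) auto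
  ultimately show ?thesis unfolding tail_def by simp
qed

text \<open>Near \<open>l\<close> the improper integral is a proper one up to a fixed
  \<open>b\<close> plus the constant \<open>tail b\<close>, so the fundamental theorem of calculus
  applies. The interval from \<open>l / 2\<close> to \<open>b\<close> has \<open>l\<close> in its
  interior and stays away from 0.\<close>

lemma tail_has_derivative:
  assumes "0 < l"
  shows "(tail has_real_derivative - (1 / \<psi> l)) (at l)"
proof -
  define b where "b = l + 1"
  have "((\<lambda>x. integral {x..b} (\<lambda>\<xi>. 1 / \<psi> \<xi>)) has_real_derivative - (1 / \<psi> l))
      (at l within {l / 2..b})"
  proof (rule integral_has_real_derivative')
    show "continuous_on {l / 2..b} (\<lambda>\<xi>. 1 / \<psi> \<xi>)"
      using assms pos
      by (intro continuous_on_divide continuous_on_const continuous_on_subset[OF cont])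
        (force simp: less_imp_neq[symmetric])+
  qed (use assms in \<open>auto simp: b_def\<close>)
  moreover have "at l within {l / 2..b} = at l"
    using assms by (intro at_within_interior) (auto simp: b_def)
  ultimately have "((\<lambda>x. integral {x..b} (\<lambda>\<xi>. 1 / \<psi> \<xi>) + tail b) has_real_derivative - (1 / \<psi> l))
      (at l)"
    by (auto intro!: derivative_eq_intros)
  then show ?thesis
  proof (rule has_field_derivative_transform_within_open[where S = "{l / 2<..<b}"])
    fix x assume "x \<in> {l / 2<..<b}"
    then show "integral {x..b} (\<lambda>\<xi>. 1 / \<psi> \<xi>) + tail b = tail x"
      using assms by (subst tail_split[of x b]) auto
  qed (use assms in \<open>auto simp: b_def\<close>)
qed

text \<open>Between \<open>a\<close> and \<open>b\<close> the integrand
  \<open>1 / (x * slope x)\<close> is at least \<open>1 / (x * slope b)\<close>, whose integral is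
  the logarithm. The comparison is made through the sign of a derivative.\<close>

lemma tail_diff_lower:
  assumes "0 < a" "a \<le> b"
  shows "ln (b / a) / slope b \<le> tail a - tail b"
proof -
  have "tail b + ln b / slope b \<le> tail a + ln a / slope b"
  proof (rule DERIV_nonpos_imp_nonincreasing[OF assms(2)])
    fix x assume x: "a \<le> x" "x \<le> b"
    then have x0: "0 < x" using assms by simp
    have "((\<lambda>x. tail x + ln x / slope b) has_real_derivative
        - (1 / \<psi> x) + 1 / x / slope b) (at x)"
      using x0 tail_has_derivative slope_pos[of b] assms by (auto intro!: derivative_eq_intros)
    moreover have "1 / x / slope b \<le> 1 / x / slope x"
      using x x0 slope_mono[of x b] slope_pos[of x]
      by (intro divide_left_mono mult_pos_pos) (auto simp: slope_def pos)
    ultimately show "\<exists>y. ((\<lambda>x. tail x + ln x / slope b) has_real_derivative y) (at x) \<and> y \<le> 0"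
      using x0 by (intro exI conjI) (auto simp: slope_def)
  qed
  then show ?thesis using assms by (simp add: ln_div diff_divide_distrib)
qed

text \<open>The same comparison with the slope frozen at the left end, where it is smallest.\<close>

lemma tail_diff_upper:
  assumes "0 < a" "a \<le> b"
  shows "tail a - tail b \<le> ln (b / a) / slope a"
proof -
  have "tail a + ln a / slope a \<le> tail b + ln b / slope a"
  proof (rule DERIV_nonneg_imp_nondecreasing[OF assms(2)])
    fix x assume x: "a \<le> x" "x \<le> b"
    then have x0: "0 < x" using assms by simp
    have "((\<lambda>x. tail x + ln x / slope a) has_real_derivative
        - (1 / \<psi> x) + 1 / x / slope a) (at x)"
      using x0 tail_has_derivative slope_pos[of a] assms by (auto intro!: derivative_eq_intros)
    moreover have "1 / x / slope x \<le> 1 / x / slope a"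
      using x x0 slope_mono[of a x] slope_pos[of a] assms
      by (intro divide_left_mono mult_pos_pos) (auto simp: slope_def pos)
    ultimately show "\<exists>y. ((\<lambda>x. tail x + ln x / slope a) has_real_derivative y) (at x) \<and> 0 \<le> y"
      using x0 by (intro exI conjI) (auto simp: slope_def)
  qed
  then show ?thesis using assms by (simp add: ln_div diff_divide_distrib)
qed

section \<open>Monotonicity and inversion of the tail integral, and the cumulant in closed
  form\<close>

lemma tail_strict_antimono:
  assumes "0 < a" "a < b"
  shows "tail b < tail a"
proof -
  have "0 < ln (b / a) / slope b" using assms slope_pos[of b] by simp
  then show ?thesis using tail_diff_lower[of a b] assms by linarith
qed

lemma tail_less_iff: "0 < a \<Longrightarrow> 0 < b \<Longrightarrow> tail a < tail b \<longleftrightarrow> b < a"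
  using tail_strict_antimono[of a b] tail_strict_antimono[of b a] by (cases a b rule: linorder_cases) auto

lemma tail_le_iff: "0 < a \<Longrightarrow> 0 < b \<Longrightarrow> tail a \<le> tail b \<longleftrightarrow> b \<le> a"
  using tail_less_iff[of b a] by (auto simp: not_less[symmetric])

lemma tail_nonneg: "0 < l \<Longrightarrow> 0 \<le> tail l"
  unfolding tail_def set_lebesgue_integral_def
  by (intro integral_nonneg_AE AE_I2) (auto simp: indicator_def less_imp_le pos)

lemma tail_pos: "0 < l \<Longrightarrow> 0 < tail l"
  using tail_strict_antimono[of l "l + 1"] tail_nonneg[of "l + 1"] by auto

lemma tail_at_top: "(tail \<longlongrightarrow> 0) at_top"
proof -
  have "((\<lambda>b. (LINT \<xi>:{1..b}|lborel. 1 / \<psi> \<xi>)) \<longlongrightarrow> tail 1) at_top"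
    unfolding tail_def by (intro tendsto_set_lebesgue_integral_at_top tail_integrable) auto
  then have "((\<lambda>b. tail 1 - (LINT \<xi>:{1..b}|lborel. 1 / \<psi> \<xi>)) \<longlongrightarrow> tail 1 - tail 1) at_top"
    by (intro tendsto_intros)
  moreover have "\<forall>\<^sub>F b in at_top. tail 1 - (LINT \<xi>:{1..b}|lborel. 1 / \<psi> \<xi>) = tail b"
    using eventually_ge_at_top[of 1]
  proof eventually_elim
    case (elim b)
    then have "(LINT \<xi>:{1..b}|lborel. 1 / \<psi> \<xi>) = integral {1..b} (\<lambda>\<xi>. 1 / \<psi> \<xi>)"
      by (intro set_borel_integral_eq_integral set_integrable_subset[OF tail_integrable[of 1]]) auto
    then show ?case using tail_split[of 1 b] elim by simp
  qed
  ultimately show ?thesis by (simp add: tendsto_cong)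
qed

lemma ex_tail_eq:
  assumes "0 < s"
  shows "\<exists>l>0. tail l = s"
proof -
  obtain b where b: "0 < b" "tail b < s"
    using eventually_happens'[OF _ eventually_conj[OF order_tendstoD(2)[OF tail_at_top assms]
      eventually_gt_at_top[of 0]]] by auto
  \<comment> \<open>Chosen to make \<open>ln (b / a) / slope b\<close> equal to \<open>s\<close>, so
    that \<open>tail_diff_lower\<close> forces \<open>s \<le> tail a\<close>. In particular
    \<open>tail\<close> is unbounded near 0.\<close>
  define a where "a = b / exp (s * slope b)"
  have a: "0 < a" "a \<le> b" using b assms slope_pos[of b] by (auto simp: a_def field_simps)
  have "ln (b / a) = s * slope b" using b by (simp add: a_def)
  then have "s \<le> tail a"
    using tail_diff_lower[OF a] tail_nonneg[of b] slope_pos[of b] b by simp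
  then obtain x where "a \<le> x" "x \<le> b" "tail x = s"
    using IVT2'[of tail b s a] a b
      DERIV_continuous_on[of "{a..b}" tail "\<lambda>x. - (1 / \<psi> x)"] tail_has_derivative
    by (metis atLeastAtMost_iff has_field_derivative_at_within less_eq_real_def less_le_trans)
  then show ?thesis using a by (intro exI[of _ x]) auto
qed

text \<open>For positive \<open>t\<close>, \<open>tail_inv t\<close> is the \<open>v\<^sub>t\<close>
  of the overview, the limit of \<open>u\<^sub>t l\<close> as \<open>l\<close> tends to infinity.
  Only positive arguments are meaningful.\<close>

definition tail_inv :: "real \<Rightarrow> real" where
  "tail_inv s = (SOME l. 0 < l \<and> tail l = s)"

lemma tail_inv: "0 < s \<Longrightarrow> 0 < tail_inv s" "0 < s \<Longrightarrow> tail (tail_inv s) = s"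
  using someI_ex[OF ex_tail_eq[of s, simplified Bex_def]] unfolding tail_inv_def by auto

lemma tail_inv_tail: "0 < l \<Longrightarrow> tail_inv (tail l) = l"
  using tail_inv[of "tail l"] tail_pos[of l] tail_less_iff[of l "tail_inv (tail l)"]
    tail_less_iff[of "tail_inv (tail l)" l] by (metis less_irrefl linorder_less_linear)

lemma tail_inv_less_iff: "0 < s \<Longrightarrow> 0 < l \<Longrightarrow> tail_inv s < l \<longleftrightarrow> tail l < s"
  using tail_less_iff[of l "tail_inv s"] tail_inv[of s] by auto

lemma less_tail_inv_iff: "0 < s \<Longrightarrow> 0 < l \<Longrightarrow> l < tail_inv s \<longleftrightarrow> s < tail l"
  using tail_less_iff[of "tail_inv s" l] tail_inv[of s] by auto

lemma tail_inv_at_top: "filterlim tail_inv (at_right 0) at_top"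
  unfolding filterlim_at
proof
  show "(tail_inv \<longlongrightarrow> 0) at_top"
  proof (rule order_tendstoI)
    fix a :: real assume "a < 0"
    show "\<forall>\<^sub>F s in at_top. a < tail_inv s"
      using eventually_gt_at_top[of 0] proof eventually_elim
      case (elim s)
      then show ?case using \<open>a < 0\<close> tail_inv(1)[of s] by linarith
    qed
  next
    fix a :: real assume "0 < a"
    show "\<forall>\<^sub>F s in at_top. tail_inv s < a"
      using eventually_gt_at_top[of 0] eventually_gt_at_top[of "tail a"]
      by eventually_elim (simp add: tail_inv_less_iff \<open>0 < a\<close>)
  qed
  show "\<forall>\<^sub>F s in at_top. tail_inv s \<in> {0<..} \<and> tail_inv s \<noteq> 0"
    using eventually_gt_at_top[of 0] by eventually_elim (auto dest: tail_inv(1))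
qed

text \<open>This is the convergence of \<open>u\<^sub>t l\<close> to \<open>v\<^sub>t\<close>, which
  turns Laplace transforms into extinction probabilities. The upper estimate is immediate since
  \<open>tail l\<close> is positive; the lower one uses that \<open>tail l\<close> vanishes at
  infinity.\<close>

lemma tail_inv_add_tail_tendsto:
  assumes "0 < t"
  shows "((\<lambda>l. tail_inv (t + tail l)) \<longlongrightarrow> tail_inv t) at_top"
proof (rule order_tendstoI)
  fix a assume a: "a < tail_inv t"
  show "\<forall>\<^sub>F l in at_top. a < tail_inv (t + tail l)"
  proof (cases "0 < a")
    case True
    then have "t < tail a" using a assms by (simp add: less_tail_inv_iff)
    then have "\<forall>\<^sub>F l in at_top. tail l < tail a - t"
      by (intro order_tendstoD[OF tail_at_top]) simp
    with eventually_gt_at_top[of 0] show ?thesis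
    proof eventually_elim
      case (elim l)
      then show ?case using True assms tail_pos[of l] by (simp add: less_tail_inv_iff)
    qed
  next
    case False
    from eventually_gt_at_top[of 0] show ?thesis
    proof eventually_elim
      case (elim l)
      then show ?case using False assms tail_pos[of l] tail_inv(1)[of "t + tail l"] by simp
    qed
  qed
next
  fix a assume a: "tail_inv t < a"
  from eventually_gt_at_top[of 0] show "\<forall>\<^sub>F l in at_top. tail_inv (t + tail l) < a"
  proof eventually_elim
    case (elim l)
    then have "tail_inv (t + tail l) < tail_inv t"
      using assms tail_pos[of l] tail_inv[of t] by (subst tail_inv_less_iff) auto
    then show ?case using a by simp
  qed
qed

text \<open>Separation of variables: by the chain rule \<open>tail (u s)\<close> has derivative 1,
  so \<open>tail (u s) - s\<close> is constant. This also shows that the positive solution is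
  unique.\<close>

lemma positive_cumulant_eq:
  assumes "positive_cumulant \<psi> l u" "0 < l" "0 \<le> t"
  shows "u t = tail_inv (t + tail l)"
proof -
  have u: "0 < u s" "(u has_real_derivative - \<psi> (u s)) (at s within {0..})" if "0 \<le> s" for s
    using assms(1) that by (auto simp: positive_cumulant_def)
  have "((\<lambda>s. tail (u s) - s) has_real_derivative 0) (at s within {0..})" if "0 \<le> s" for s
    using DERIV_chain2[OF tail_has_derivative[OF u(1)[OF that]] u(2)[OF that]] pos[OF u(1)[OF that]]
    by (auto intro!: derivative_eq_intros)
  then have "\<exists>c. \<forall>s\<in>{0..}. tail (u s) - s = c"
    by (intro has_field_derivative_zero_constant convex_real_interval) auto
  then obtain c where "\<And>s. 0 \<le> s \<Longrightarrow> tail (u s) - s = c" by auto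
  from this[of t] this[of 0] have "tail (u t) - t = tail (u 0) - 0"
    using assms(3) by simp
  moreover have "u 0 = l" using assms(1) by (simp add: positive_cumulant_def)
  ultimately have "tail (u t) = t + tail l" by simp
  then show ?thesis using tail_inv_tail[OF u(1)[OF assms(3)]] by simp
qed

section \<open>Asymptotics of the slope and of the tail integral near 0\<close>

lemma slope_tendsto_0: "(slope \<longlongrightarrow> 0) (at_right 0)"
  using slope_0 by (simp add: slope_def[abs_def])

lemma slope_scale: "0 < c \<Longrightarrow> ((\<lambda>l. slope (c * l) / slope l) \<longlongrightarrow> 1) (at_right 0)"
  using slope_var by (simp add: slope_def)

lemma slope_le: "0 < a \<Longrightarrow> a \<le> b \<Longrightarrow> slope a \<le> slope b"
  using slope_mono by (simp add: slope_def)

text \<open>For each \<open>c > 1\<close>, \<open>tail l\<close> is at least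
  \<open>ln c / slope (c * l)\<close>, and slow variation makes
  \<open>slope l / slope (c * l)\<close> tend to 1. So the product is eventually above any number
  below \<open>ln c\<close>, and \<open>c\<close> is arbitrary.\<close>

lemma slope_times_tail_at_top: "filterlim (\<lambda>l. slope l * tail l) at_top (at_right 0)"
  unfolding filterlim_at_top
proof
  fix Z :: real
  \<comment> \<open>The absolute value secures \<open>1 < c\<close> for negative \<open>Z\<close>,
    and the added 1 makes \<open>ln c\<close> strictly larger than \<open>Z\<close>.\<close>
  define c where "c = exp (\<bar>Z\<bar> + 1)"
  have c: "1 < c" "ln c = \<bar>Z\<bar> + 1" by (auto simp: c_def)
  have "((\<lambda>l. ln c / (slope (c * l) / slope l)) \<longlongrightarrow> ln c / 1) (at_right 0)"
    using c by (intro tendsto_intros slope_scale) auto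
  then have "\<forall>\<^sub>F l in at_right 0. Z < ln c / (slope (c * l) / slope l)"
    by (rule order_tendstoD) (use c in auto)
  with eventually_at_right_less[of 0] show "\<forall>\<^sub>F l in at_right 0. Z \<le> slope l * tail l"
  proof eventually_elim
    case (elim l)
    have cl: "0 < c * l" "l \<le> c * l" using c elim by auto
    have "ln c / slope (c * l) \<le> tail l"
      using tail_diff_lower[of l "c * l"] tail_nonneg[of "c * l"] cl elim by simp
    then have "slope l * (ln c / slope (c * l)) \<le> slope l * tail l"
      using slope_pos[of l] elim by (intro mult_left_mono) auto
    then show ?case using elim by (simp add: mult.commute)
  qed
qed

text \<open>The relative loss \<open>(tail l - tail (c * l)) / tail l\<close> is at most
  \<open>ln c / (slope l * tail l)\<close>, whose denominator tends to infinity.\<close>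

lemma tail_scale:
  assumes "1 < c"
  shows "((\<lambda>l. tail (c * l) / tail l) \<longlongrightarrow> 1) (at_right 0)"
proof (rule tendsto_sandwich)
  have "((\<lambda>l. 1 - ln c / (slope l * tail l)) \<longlongrightarrow> 1 - 0) (at_right 0)"
    by (intro tendsto_intros real_tendsto_divide_at_top[OF tendsto_const slope_times_tail_at_top])
  then show "((\<lambda>l. 1 - ln c / (slope l * tail l)) \<longlongrightarrow> 1) (at_right 0)" by simp
  show "\<forall>\<^sub>F l in at_right 0. 1 - ln c / (slope l * tail l) \<le> tail (c * l) / tail l"
    using eventually_at_right_less[of 0]
  proof eventually_elim
    case (elim l)
    have "tail l - tail (c * l) \<le> ln c / slope l"
      using tail_diff_upper[of l "c * l"] assms elim by simp
    then have "(tail l - tail (c * l)) / tail l \<le> ln c / slope l / tail l"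
      using tail_pos[OF elim] by (intro divide_right_mono) auto
    then show ?case using tail_pos[OF elim] by (simp add: diff_divide_distrib)
  qed
  show "\<forall>\<^sub>F l in at_right 0. tail (c * l) / tail l \<le> 1"
    using eventually_at_right_less[of 0]
  proof eventually_elim
    case (elim l)
    then have "tail (c * l) < tail l" using assms by (intro tail_strict_antimono) auto
    then show ?case using tail_pos[OF elim] by simp
  qed
qed simp

text \<open>In units of \<open>1 / slope (v t)\<close> the difference of tails measures
  \<open>ln (v t / u t)\<close>. Each bound compares \<open>tail (u t)\<close> with the tail at a
  fixed multiple of \<open>v t\<close>. The lower bound involves \<open>slope (v t)\<close> itself;
  only the upper one calls on slow variation.\<close>

lemma cumulant_ratio_tendsto:
  assumes v: "filterlim v (at_right 0) F"
    and u: "\<forall>\<^sub>F t in F. 0 < u t"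
    and y: "0 < y"
    and lim: "((\<lambda>t. (tail (u t) - tail (v t)) * slope (v t)) \<longlongrightarrow> y) F"
  shows "((\<lambda>t. u t / v t) \<longlongrightarrow> exp (- y)) F"
proof -
  have v0: "\<forall>\<^sub>F t in F. 0 < v t"
    using v by (auto simp: filterlim_at elim: eventually_mono)
  show ?thesis
  proof (rule order_tendstoI)
    fix a assume a: "a < exp (- y)"
    show "\<forall>\<^sub>F t in F. a < u t / v t"
    proof (cases "0 < a")
      case True
      have "exp (- y) < 1" using y by simp
      then have a1: "a < 1" using a by linarith
      have "ln a < - y" using a True by (metis exp_ln exp_less_cancel_iff)
      then have "y < ln (1 / a)" using True by (simp add: ln_div)
      then have "\<forall>\<^sub>F t in F. (tail (u t) - tail (v t)) * slope (v t) < ln (1 / a)"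
        by (rule order_tendstoD[OF lim])
      with u v0 show ?thesis
      proof eventually_elim
        case (elim t)
        have "ln (v t / (a * v t)) / slope (v t) \<le> tail (a * v t) - tail (v t)"
          using True a1 elim by (intro tail_diff_lower) auto
        then have "ln (1 / a) / slope (v t) \<le> tail (a * v t) - tail (v t)"
          using elim by simp
        moreover have "tail (u t) - tail (v t) < ln (1 / a) / slope (v t)"
          using elim slope_pos[of "v t"] by (simp add: pos_less_divide_eq)
        ultimately have "tail (u t) < tail (a * v t)" by simp
        then show ?case using tail_less_iff[of "u t" "a * v t"] True elim
          by (simp add: pos_less_divide_eq)
      qed
    next
      case False
      from u v0 show ?thesis
        by eventually_elim (use False in \<open>meson divide_pos_pos le_less_trans not_less\<close>)
    qed
  next
    fix b assume b: "exp (- y) < b"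
    \<comment> \<open>\<open>b\<close> may exceed 1, whereas \<open>tail_diff_upper\<close> is to be
      applied from \<open>c * v t\<close> to \<open>v t\<close>, which asks for
      \<open>c < 1\<close>.\<close>
    have "exp (- y) < min b 1" using b y by simp
    then obtain c where c: "exp (- y) < c" "c < b" "c < 1"
      using dense by (metis min_less_iff_conj)
    have c0: "0 < c" using c exp_gt_zero[of "- y"] by linarith
    have "- y < ln c" using c c0 by (metis exp_ln exp_less_cancel_iff)
    then have "ln (1 / c) < y" using c0 by (simp add: ln_div)
    \<comment> \<open>\<open>tail_diff_upper\<close> produces \<open>slope (c * v t)\<close>; slow
      variation trades it for \<open>slope (v t)\<close> in the limit.\<close>
    have "((\<lambda>t. ln (1 / c) / (slope (c * v t) / slope (v t))) \<longlongrightarrow> ln (1 / c) / 1) F"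
      using c0 by (intro tendsto_intros filterlim_compose[OF slope_scale v]) auto
    from tendsto_diff[OF lim this] have "((\<lambda>t. (tail (u t) - tail (v t)) * slope (v t)
        - ln (1 / c) / (slope (c * v t) / slope (v t))) \<longlongrightarrow> y - ln (1 / c) / 1) F" .
    then have "\<forall>\<^sub>F t in F. 0 < (tail (u t) - tail (v t)) * slope (v t)
        - ln (1 / c) / (slope (c * v t) / slope (v t))"
      by (rule order_tendstoD) (use \<open>ln (1 / c) < y\<close> in simp)
    with u v0 show "\<forall>\<^sub>F t in F. u t / v t < b"
    proof eventually_elim
      case (elim t)
      have sl: "0 < slope (v t)" using elim slope_pos by blast
      have "tail (c * v t) - tail (v t) \<le> ln (v t / (c * v t)) / slope (c * v t)"
        using c c0 elim by (intro tail_diff_upper) auto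
      then have "tail (c * v t) - tail (v t) \<le> ln (1 / c) / slope (c * v t)"
        using elim by simp
      moreover have "ln (1 / c) / slope (c * v t) * slope (v t)
          < (tail (u t) - tail (v t)) * slope (v t)" using elim by simp
      then have "ln (1 / c) / slope (c * v t) < tail (u t) - tail (v t)"
        using sl by (simp only: mult_less_cancel_right_pos)
      ultimately have "tail (c * v t) < tail (u t)" by simp
      then have "u t < c * v t" using tail_less_iff[of "c * v t" "u t"] c0 elim by simp
      then have "u t / v t < c" using elim by (simp add: pos_divide_less_eq)
      then show ?case using c by linarith
    qed
  qed
qed

text \<open>This allows the survival probability to stand in for \<open>v\<^sub>t\<close>:
  monotonicity squeezes the slope at \<open>q t\<close> between the slopes at half of
  \<open>v t\<close> and at \<open>v t\<close>.\<close>

lemma slope_ratio_tendsto: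
  assumes v: "filterlim v (at_right 0) F"
    and q: "\<forall>\<^sub>F t in F. v t / 2 \<le> q t \<and> q t \<le> v t"
  shows "((\<lambda>t. slope (q t) / slope (v t)) \<longlongrightarrow> 1) F"
proof (rule tendsto_sandwich)
  have v0: "\<forall>\<^sub>F t in F. 0 < v t"
    using v by (auto simp: filterlim_at elim: eventually_mono)
  show "((\<lambda>t. slope (1 / 2 * v t) / slope (v t)) \<longlongrightarrow> 1) F"
    by (intro filterlim_compose[OF slope_scale v]) simp
  show "\<forall>\<^sub>F t in F. slope (1 / 2 * v t) / slope (v t) \<le> slope (q t) / slope (v t)"
    using q v0
    by eventually_elim (auto intro!: divide_right_mono slope_le less_imp_le[OF slope_pos])
  show "\<forall>\<^sub>F t in F. slope (q t) / slope (v t) \<le> 1"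
    using q v0
  proof eventually_elim
    case (elim t)
    then have "slope (q t) \<le> slope (v t)" by (intro slope_le) auto
    then show ?case using slope_pos[of "v t"] elim by simp
  qed
qed simp

text \<open>The same squeeze for the tail integral, in reversed order because \<open>tail\<close>
  decreases; the outer ratio is \<open>tail_scale\<close> with factor 2 at
  \<open>v t / 2\<close>.\<close>

lemma tail_ratio_tendsto:
  assumes v: "filterlim v (at_right 0) F"
    and q: "\<forall>\<^sub>F t in F. v t / 2 \<le> q t \<and> q t \<le> v t"
  shows "((\<lambda>t. tail (q t) / tail (v t)) \<longlongrightarrow> 1) F"
proof (rule tendsto_sandwich[where f = "\<lambda>_. 1" and h = "\<lambda>t. tail (v t / 2) / tail (v t)"])
  have v0: "\<forall>\<^sub>F t in F. 0 < v t"
    using v by (auto simp: filterlim_at elim: eventually_mono)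
  have "filterlim (\<lambda>t. v t / 2) (at_right 0) F"
    using v by (auto simp: filterlim_at intro: tendsto_divide_zero elim: eventually_mono)
  then have "((\<lambda>t. tail (2 * (v t / 2)) / tail (v t / 2)) \<longlongrightarrow> 1) F"
    by (rule filterlim_compose[OF tail_scale, rotated]) simp
  then have "((\<lambda>t. inverse (tail (2 * (v t / 2)) / tail (v t / 2))) \<longlongrightarrow> inverse 1) F"
    by (rule tendsto_inverse) simp
  then show "((\<lambda>t. tail (v t / 2) / tail (v t)) \<longlongrightarrow> 1) F" by simp
  show "\<forall>\<^sub>F t in F. tail (q t) / tail (v t) \<le> tail (v t / 2) / tail (v t)"
    using q v0
    by eventually_elim (auto intro!: divide_right_mono less_imp_le[OF tail_pos] simp: tail_le_iff)
  show "\<forall>\<^sub>F t in F. 1 \<le> tail (q t) / tail (v t)"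
    using q v0
  proof eventually_elim
    case (elim t)
    then have "tail (v t) \<le> tail (q t)" by (subst tail_le_iff) auto
    then show ?case using tail_pos[of "v t"] elim by simp
  qed
qed simp

text \<open>Slow variation of \<^term>\<open>tail\<close> at \<open>0\<close> makes its inverse rapidly varying, which is what
  lets Laplace transforms be read as distribution functions.\<close>

lemma tail_inv_ratio_tendsto_0:
  assumes h: "filterlim h at_top F" and y: "0 < y" "y < z"
  shows "((\<lambda>t. tail_inv (z * h t) / tail_inv (y * h t)) \<longlongrightarrow> 0) F"
proof -
  have h0: "\<forall>\<^sub>F t in F. 0 < h t" using h by (simp add: filterlim_at_top_dense)
  show ?thesis
  proof (rule order_tendstoI)
    fix a :: real assume "a < 0"
    from h0 show "\<forall>\<^sub>F t in F. a < tail_inv (z * h t) / tail_inv (y * h t)"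
    proof eventually_elim
      case (elim t)
      then have "0 < tail_inv (z * h t) / tail_inv (y * h t)"
        using y by (intro divide_pos_pos tail_inv) auto
      then show ?case using \<open>a < 0\<close> by linarith
    qed
  next
    fix a :: real assume "0 < a"
    \<comment> \<open>The first entry secures \<open>1 < c\<close>, as \<open>tail_scale\<close>
      asks, and the second gives \<open>1 / c < a\<close> strictly.\<close>
    define c where "c = max 2 (2 / a)"
    have c: "1 < c" "1 / c < a" using \<open>0 < a\<close>
      by (auto simp: c_def field_simps max_def)
    have "filterlim (\<lambda>t. z * h t) at_top F"
      using y by (intro filterlim_tendsto_pos_mult_at_top[OF tendsto_const _ h]) auto
    then have "filterlim (\<lambda>t. tail_inv (z * h t)) (at_right 0) F"
      by (rule filterlim_compose[OF tail_inv_at_top])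
    then have "((\<lambda>t. tail (c * tail_inv (z * h t)) / tail (tail_inv (z * h t))) \<longlongrightarrow> 1) F"
      by (rule filterlim_compose[OF tail_scale[OF c(1)]])
    \<comment> \<open>The limit 1 exceeds \<open>y / z\<close>. So enlarging
      \<open>tail_inv (z * h t)\<close> by the factor \<open>c\<close> still leaves its tail above
      \<open>y * h t\<close>, that is, below \<open>tail_inv (y * h t)\<close> on the original
      scale.\<close>
    then have "\<forall>\<^sub>F t in F. y / z < tail (c * tail_inv (z * h t)) / tail (tail_inv (z * h t))"
      by (rule order_tendstoD) (use y in simp)
    with h0 show "\<forall>\<^sub>F t in F. tail_inv (z * h t) / tail_inv (y * h t) < a"
    proof eventually_elim
      case (elim t)
      have p: "0 < y * h t" "0 < z * h t" using y elim by auto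
      have "y / z * (z * h t) < tail (c * tail_inv (z * h t))"
        using elim p tail_inv(2)[of "z * h t"] by (simp add: pos_less_divide_eq)
      then have "y * h t < tail (c * tail_inv (z * h t))" using y by simp
      then have "c * tail_inv (z * h t) < tail_inv (y * h t)"
        using p tail_inv(1)[of "z * h t"] c by (simp add: less_tail_inv_iff)
      then have "tail_inv (z * h t) / tail_inv (y * h t) < 1 / c"
        using c tail_inv(1)[of "y * h t"] p by (simp add: field_simps)
      then show ?case using c by linarith
    qed
  qed
qed

text \<open>The change of variable is made by recognising \<open>tail (1 / z)\<close> as an
  antiderivative of the new integrand; it vanishes as \<open>z\<close> decreases to 0 because
  \<open>tail\<close> vanishes at infinity.\<close>

lemma tail_substitution:
  assumes "0 < x"
  shows "tail (1 / x) = (LINT \<xi>:{0<..<x}|lborel. 1 / (\<xi> * slope (1 / \<xi>)))"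
proof -
  have eq: "1 / (z * slope (1 / z)) = 1 / \<psi> (1 / z) * (1 / z\<^sup>2)" if "0 < z" for z
    using that by (simp add: slope_def power2_eq_square)
  have deriv: "((\<lambda>z. tail (1 / z)) has_real_derivative 1 / (z * slope (1 / z))) (at z)"
    if "0 < z" for z
  proof -
    have "((\<lambda>z. 1 / z) has_real_derivative - (1 / z\<^sup>2)) (at z)"
      using that by (auto intro!: derivative_eq_intros simp: power2_eq_square)
    from DERIV_chain2[OF tail_has_derivative this] show ?thesis using that by (simp add: eq)
  qed
  have "(LBINT \<xi>=0..ereal x. 1 / (\<xi> * slope (1 / \<xi>))) = tail (1 / x) - 0"
  proof (rule interval_integral_FTC_nonneg(2))
    fix z assume "0 < ereal z" "ereal z < ereal x"
    then have z: "0 < z" by simp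
    then show "((\<lambda>z. tail (1 / z)) has_real_derivative 1 / (z * slope (1 / z))) (at z)"
      by (rule deriv)
    have "isCont (\<lambda>z. 1 / (z * (\<psi> (1 / z) / (1 / z)))) z"
      using z pos[of "1 / z"]
      by (intro continuous_intros isCont_o2[of z "\<lambda>z. 1 / z" \<psi>] isCont_mechanism) auto
    then show "isCont (\<lambda>z. 1 / (z * slope (1 / z))) z" by (simp add: slope_def)
  next
    show "AE z in lborel. 0 < ereal z \<longrightarrow> ereal z < ereal x \<longrightarrow> 0 \<le> 1 / (z * slope (1 / z))"
      by (intro AE_I2) (auto intro!: divide_nonneg_nonneg mult_nonneg_nonneg less_imp_le[OF slope_pos])
    have "((\<lambda>z. tail (inverse z)) \<longlongrightarrow> 0) (at_right 0)"
      by (rule filterlim_compose[OF tail_at_top filterlim_inverse_at_top_right])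
    then show "(((\<lambda>z. tail (1 / z)) \<circ> real_of_ereal) \<longlongrightarrow> 0) (at_right 0)"
      unfolding zero_ereal_def by (simp only: ereal_tendsto_simps inverse_eq_divide)
    have "((\<lambda>z. tail (1 / z)) \<longlongrightarrow> tail (1 / x)) (at_left x)"
      using DERIV_isCont[OF deriv[OF assms]] by (simp add: isCont_def filterlim_at_split)
    then show "(((\<lambda>z. tail (1 / z)) \<circ> real_of_ereal) \<longlongrightarrow> tail (1 / x)) (at_left (ereal x))"
      by (simp only: ereal_tendsto_simps)
  qed (use assms in simp)
  moreover have "einterval 0 (ereal x) = {0<..<x}" by (auto simp: einterval_def)
  ultimately show ?thesis using assms by (simp add: interval_lebesgue_integral_def)
qed

lemma V_of_eq: "x \<noteq> 0 \<Longrightarrow> V_of \<psi> x = tail (1 / x)"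
  by (simp add: V_of_def tail_def)

end

section \<open>Absorption at zero\<close>

context cb_process
begin

lemma space_P: "0 < x \<Longrightarrow> space (P x) = space M"
  by (rule sets_eq_imp_space_eq[OF sets_P])

lemma measurable_P [measurable (raw)]:
  "0 < x \<Longrightarrow> 0 \<le> t \<Longrightarrow> X t \<in> borel_measurable (P x)"
  using measurable_X by (subst measurable_cong_sets[OF sets_P refl])

lemma sets_P_Collect:
  assumes "0 < x" "0 \<le> t" "B \<in> sets borel"
  shows "{\<omega> \<in> space M. X t \<omega> \<in> B} \<in> sets (P x)"
  using measurable_sets[OF measurable_P[OF assms(1,2)] assms(3)] assms(1)
  by (simp add: space_P vimage_def Int_def conj_commute)

lemma sets_natural_filtration:
  "sets (natural_filtration M X t) =
    sigma_sets (space M) {X s -` B \<inter> space M | s B. 0 \<le> s \<and> ennreal s \<le> t \<and> B \<in> sets borel}"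
  unfolding natural_filtration_def by (rule sets_measure_of) auto

lemma natural_filtration_Collect:
  assumes "0 \<le> r" "r \<le> s" "B \<in> sets borel"
  shows "{\<omega> \<in> space M. X r \<omega> \<in> B} \<in> sets (natural_filtration M X (ennreal s))"
proof -
  have "X r -` B \<inter> space M \<in> sets (natural_filtration M X (ennreal s))"
    unfolding sets_natural_filtration using assms by (intro sigma_sets.Basic) (auto intro!: ennreal_leI)
  then show ?thesis by (simp add: vimage_def Int_def conj_commute)
qed

lemma natural_filtration_le: "sets (natural_filtration M X t) \<subseteq> sets M"
  unfolding sets_natural_filtration
  by (rule sets.sigma_sets_subset) (auto intro: measurable_sets measurable_X)

lemma natural_filtration_mono:
  "s \<le> t \<Longrightarrow> sets (natural_filtration M X s) \<subseteq> sets (natural_filtration M X t)"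
  by (rule filtration.sets_F_mono[OF filtration_natural_filtration])

text \<open>The strong Markov property at a constant stopping time. Membership in the stopped
  sigma-algebra is clear because each set to be tested is \<open>A\<close> or empty.\<close>

lemma simple_markov:
  assumes "0 < x" "0 \<le> s" "0 \<le> t" "A \<in> sets (natural_filtration M X (ennreal s))" "B \<in> sets borel"
  shows "measure (P x) {\<omega> \<in> A. X (s + t) \<omega> \<in> B} =
    (\<integral>\<omega>. indicator A \<omega> * measure (transition P X t (X s \<omega>)) B \<partial>P x)"
proof -
  interpret filtration "space M" "natural_filtration M X" by (rule filtration_natural_filtration)
  have "A \<in> sets (pre_sigma (\<lambda>_. ennreal s))"
  proof (rule sets_pre_sigmaI[OF stopping_time_const])
    fix r
    show "{\<omega> \<in> A. ennreal s \<le> r} \<in> sets (natural_filtration M X r)"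
      using assms(4) natural_filtration_mono[of "ennreal s" r] by (cases "ennreal s \<le> r") auto
  qed
  from strong_markov[OF assms(1,3) stopping_time_const this assms(5)] show ?thesis
    using assms(2) by simp
qed

text \<open>By right continuity the infimum defining the extinction time is attained, and it differs
  from \<open>t\<close> because the path is positive there.\<close>

lemma hits_zero:
  assumes "\<omega> \<in> space M" "extinction_time X \<omega> \<le> ennreal t" "0 < X t \<omega>" "0 \<le> t"
  obtains r where "0 \<le> r" "r < t" "X r \<omega> = 0"
proof -
  define r where "r = enn2real (extinction_time X \<omega>)"
  have fin: "extinction_time X \<omega> < \<top>" using assms(2) by (simp add: le_less_trans[OF _ ennreal_less_top])
  then have r: "0 \<le> r" "ennreal r = extinction_time X \<omega>" by (auto simp: r_def)
  have "ennreal r \<le> ennreal t" using assms(2) r(2) by simp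
  then have "r \<le> t" using assms(4) by simp
  have "X r \<omega> = 0"
  proof (rule ccontr)
    assume "X r \<omega> \<noteq> 0"
    then have "0 < X r \<omega>" using X_nonneg[OF r(1) assms(1)] by simp
    moreover have "((\<lambda>s. X s \<omega>) \<longlongrightarrow> X r \<omega>) (at_right r)"
      using X_right_continuous[OF r(1) assms(1)] by (simp add: continuous_within)
    ultimately have "\<forall>\<^sub>F s in at_right r. 0 < X s \<omega>" by (intro order_tendstoD)
    then obtain b where b: "r < b" "\<And>s. r < s \<Longrightarrow> s < b \<Longrightarrow> 0 < X s \<omega>"
      by (auto simp: eventually_at_right_field)
    \<comment> \<open>A positive value at \<open>r\<close> would persist up to \<open>b\<close>,
      pushing the infimum beyond \<open>r\<close>.\<close>
    have "ennreal b \<le> extinction_time X \<omega>"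
      unfolding extinction_time_def
    proof (rule Inf_greatest)
      fix z assume "z \<in> {ennreal t |t. 0 \<le> t \<and> X t \<omega> = 0}"
      then obtain s where s: "z = ennreal s" "0 \<le> s" "X s \<omega> = 0" by auto
      then have "extinction_time X \<omega> \<le> ennreal s"
        unfolding extinction_time_def by (intro Inf_lower) auto
      then have "ennreal r \<le> ennreal s" using r(2) by simp
      then have "r \<le> s" using s(2) by simp
      moreover have "s \<noteq> r" using s \<open>X r \<omega> \<noteq> 0\<close> by auto
      ultimately have "b \<le> s" using b(2)[of s] s by force
      then show "ennreal b \<le> z" using s by (simp add: ennreal_leI)
    qed
    then have "ennreal b \<le> ennreal r" using r(2) by simp
    then show False using b(1) r(1) by simp
  qed
  moreover have "r \<noteq> t" using calculation assms(3) by auto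
  ultimately show ?thesis using that[of r] r \<open>r \<le> t\<close> by auto
qed

lemma extinction_time_le: "0 \<le> t \<Longrightarrow> X t \<omega> = 0 \<Longrightarrow> extinction_time X \<omega> \<le> ennreal t"
  unfolding extinction_time_def by (intro Inf_lower) auto

end

section \<open>Almost surely no return from zero\<close>

locale grey_cb_process = cb_process M P X \<psi> + grey_mechanism \<psi>
  for M :: "'w measure" and P X \<psi>
begin

lemma laplace_transform:
  assumes "0 < x" "0 < l" "0 \<le> t"
  shows "(\<integral>\<omega>. exp (- l * X t \<omega>) \<partial>P x) = exp (- x * tail_inv (t + tail l))"
  using laplace[OF assms(2)] positive_cumulant_eq[OF _ assms(2,3)] assms by metis

lemma integrable_exp:
  assumes "0 < x" "0 \<le> l" "0 \<le> t"
  shows "integrable (P x) (\<lambda>\<omega>. exp (- l * X t \<omega>))"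
proof -
  interpret prob_space "P x" by (rule prob_space_P[OF assms(1)])
  have [measurable]: "X t \<in> borel_measurable (P x)" using assms by measurable
  show ?thesis
    using assms X_nonneg by (intro integrable_const_bound[where B = 1] AE_I2) (auto simp: space_P)
qed

text \<open>Substitute for Doob's maximal inequality: started near \<open>0\<close>, the process is unlikely to
  exceed a given level, uniformly in time.\<close>

lemma transition_greaterThan_le:
  assumes "0 \<le> z" "0 \<le> t" "0 < \<delta>"
  shows "measure (transition P X t z) {\<delta><..} \<le> z / (1 - exp (- \<delta>))"
proof (cases "z = 0")
  case True
  then show ?thesis using assms by (simp add: transition_def measure_return)
next
  case False
  then have z: "0 < z" using assms by simp
  interpret prob_space "P z" by (rule prob_space_P[OF z])
  have [measurable]: "X t \<in> borel_measurable (P z)" using z assms by measurable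
  have e: "exp (- \<delta>) < 1" using assms by simp
  have int: "integrable (P z) (\<lambda>\<omega>. exp (- X t \<omega>))"
    using integrable_exp[of z 1 t] z assms by simp
  have "(1 - exp (- \<delta>)) * measure (P z) {\<omega> \<in> space (P z). \<delta> < X t \<omega>}
      = (\<integral>\<omega>. (1 - exp (- \<delta>)) * indicator {\<omega> \<in> space (P z). \<delta> < X t \<omega>} \<omega> \<partial>P z)"
    by simp
  \<comment> \<open>Markov's inequality for \<open>1 - exp (- X t \<omega>)\<close>, whose mean is
    known from the Laplace transform at \<open>l = 1\<close>.\<close>
  also have "\<dots> \<le> (\<integral>\<omega>. 1 - exp (- X t \<omega>) \<partial>P z)"
  proof (rule integral_mono)
    fix \<omega> assume \<omega>: "\<omega> \<in> space (P z)"
    then have "0 \<le> X t \<omega>" using X_nonneg assms z by (simp add: space_P)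
    then show "(1 - exp (- \<delta>)) * indicator {\<omega> \<in> space (P z). \<delta> < X t \<omega>} \<omega> \<le> 1 - exp (- X t \<omega>)"
      using \<omega> by (auto simp: indicator_def)
  qed (use int in \<open>auto intro!: integrable_mult_right integrable_real_indicator simp: emeasure_eq_measure\<close>)
  also have "\<dots> = 1 - exp (- z * tail_inv (t + tail 1))"
    using int laplace_transform[of z 1 t] z assms by (simp add: prob_space)
  also have "\<dots> \<le> z * tail_inv (t + tail 1)"
    using exp_ge_add_one_self[of "- z * tail_inv (t + tail 1)"] by simp
  \<comment> \<open>The cumulant started at 1 never exceeds 1, which makes the bound uniform in
    time.\<close>
  also have "\<dots> \<le> z * 1"
  proof (intro mult_left_mono)
    have "\<not> 1 < tail_inv (t + tail 1)"
      using assms tail_pos[of 1] by (subst less_tail_inv_iff) auto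
    then show "tail_inv (t + tail 1) \<le> 1" by simp
  qed (use z in simp)
  finally have "measure (P z) {\<omega> \<in> space (P z). \<delta> < X t \<omega>} \<le> z / (1 - exp (- \<delta>))"
    using e by (simp add: pos_le_divide_eq mult.commute)
  moreover have "measure (transition P X t z) {\<delta><..} = measure (P z) {\<omega> \<in> space (P z). \<delta> < X t \<omega>}"
    using False by (simp add: transition_def measure_distr vimage_def Int_def conj_commute)
  ultimately show ?thesis by simp
qed

text \<open>Decompose by the first index at which the path is at most \<epsilon>. From there the
  Markov property and \<open>transition_greaterThan_le\<close> give the same factor for every index,
  so the bound does not grow with the number of times.\<close>

lemma revival_le:
  fixes s :: "nat \<Rightarrow> real"
  assumes x: "0 < x" and \<epsilon>: "0 < \<epsilon>" and \<delta>: "0 < \<delta>" and s: "mono s" "0 \<le> s 0" and n: "\<And>k. k < n \<Longrightarrow> s k \<le> t"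
  defines "B \<equiv> \<lambda>n. {\<omega> \<in> space M. \<exists>k<n. X (s k) \<omega> \<le> \<epsilon>}"
  shows "measure (P x) {\<omega> \<in> B n. X t \<omega> \<in> {\<delta><..}} \<le> \<epsilon> / (1 - exp (- \<delta>)) * measure (P x) (B n)"
  using n
proof (induction n)
  case 0
  then show ?case by (simp add: B_def)
next
  case (Suc n)
  interpret prob_space "P x" by (rule prob_space_P[OF x])
  have s0: "0 \<le> s k" for k using s monoD[OF s(1), of 0 k] by simp
  define C where "C = \<epsilon> / (1 - exp (- \<delta>))"
  \<comment> \<open>The event that \<open>n\<close> is the first such index.\<close>
  define A where "A = {\<omega> \<in> space M. X (s n) \<omega> \<in> {..\<epsilon>}} - B n"
  have Bn: "B k = (\<Union>i<k. {\<omega> \<in> space M. X (s i) \<omega> \<in> {..\<epsilon>}})" for k by (auto simp: B_def)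
  have "B n \<in> sets (natural_filtration M X (ennreal (s n)))"
    unfolding Bn by (intro sets.finite_UN natural_filtration_Collect s0 monoD[OF s(1)]) auto
  then have A: "A \<in> sets (natural_filtration M X (ennreal (s n)))"
    unfolding A_def by (intro sets.Diff natural_filtration_Collect s0) auto
  then have AP: "A \<in> sets (P x)" using natural_filtration_le x by (auto simp: sets_P)
  have BP: "B k \<in> sets (P x)" for k
    unfolding Bn using x s0 by (intro sets.finite_UN sets_P_Collect) auto
  have t: "s n \<le> t" using Suc.prems by simp
  then have t0: "0 \<le> t" using s0[of n] by simp
  have *: "{\<omega> \<in> D. X t \<omega> \<in> {\<delta><..}} \<in> sets (P x)" if "D \<in> sets (P x)" for D
  proof -
    have "{\<omega> \<in> D. X t \<omega> \<in> {\<delta><..}} = D \<inter> {\<omega> \<in> space M. X t \<omega> \<in> {\<delta><..}}"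
      using sets.sets_into_space[OF that] x by (auto simp: space_P)
    then show ?thesis using that sets_P_Collect[OF x t0, of "{\<delta><..}"] by simp
  qed
  have BSuc: "B (Suc n) = B n \<union> A" by (auto simp: B_def A_def less_Suc_eq)
  have disj: "B n \<inter> A = {}" by (auto simp: A_def)
  have "measure (P x) {\<omega> \<in> A. X t \<omega> \<in> {\<delta><..}}
      = (\<integral>\<omega>. indicator A \<omega> * measure (transition P X (t - s n) (X (s n) \<omega>)) {\<delta><..} \<partial>P x)"
    using simple_markov[OF x s0[of n] _ A, of "t - s n" "{\<delta><..}"] t by simp
  also have "\<dots> \<le> (\<integral>\<omega>. indicator A \<omega> * C \<partial>P x)"
  proof (rule integral_mono')
    fix \<omega> assume "\<omega> \<in> space (P x)"
    then have 0: "0 \<le> X (s n) \<omega>" using X_nonneg s0 x by (simp add: space_P)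
    have "X (s n) \<omega> / (1 - exp (- \<delta>)) \<le> C" if "\<omega> \<in> A"
      using that \<delta> unfolding C_def by (intro divide_right_mono) (auto simp: A_def)
    then show "indicator A \<omega> * measure (transition P X (t - s n) (X (s n) \<omega>)) {\<delta><..}
        \<le> indicator A \<omega> * C"
      using order_trans[OF transition_greaterThan_le[OF 0 _ \<delta>, of "t - s n"]] t
      by (cases "\<omega> \<in> A") simp_all
    show "0 \<le> indicator A \<omega> * C" using \<epsilon> \<delta> by (simp add: C_def)
  qed (use AP in \<open>auto intro!: integrable_mult_left integrable_real_indicator simp: emeasure_eq_measure\<close>)
  also have "\<dots> = C * measure (P x) A" using AP by simp
  finally have A_le: "measure (P x) {\<omega> \<in> A. X t \<omega> \<in> {\<delta><..}} \<le> C * measure (P x) A" .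
  have "measure (P x) {\<omega> \<in> B (Suc n). X t \<omega> \<in> {\<delta><..}}
      = measure (P x) ({\<omega> \<in> B n. X t \<omega> \<in> {\<delta><..}} \<union> {\<omega> \<in> A. X t \<omega> \<in> {\<delta><..}})"
    by (rule arg_cong[where f = "measure (P x)"]) (auto simp: BSuc)
  also have "\<dots> = measure (P x) {\<omega> \<in> B n. X t \<omega> \<in> {\<delta><..}} + measure (P x) {\<omega> \<in> A. X t \<omega> \<in> {\<delta><..}}"
    using AP BP disj by (intro finite_measure_Union *) auto
  also have "\<dots> \<le> C * measure (P x) (B n) + C * measure (P x) A"
    using Suc A_le by (intro add_mono) (auto simp: C_def)
  also have "\<dots> = C * measure (P x) (B (Suc n))"
    unfolding BSuc using AP BP disj by (simp add: finite_measure_Union distrib_left)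
  finally show ?case by (simp add: C_def)
qed

text \<open>The event may fail to be measurable, so it is covered by a null set. A path in it
  vanishes before \<open>t\<close> and, by right continuity, stays below any \<epsilon> on an
  interval that every sufficiently fine grid meets. \<open>revival_le\<close> bounds this uniformly
  in the grid, and \<epsilon> is sent to 0.\<close>

lemma revival_null:
  assumes x: "0 < x" and t: "0 < t"
  obtains N where "N \<in> null_sets (P x)"
    "{\<omega> \<in> space M. extinction_time X \<omega> \<le> ennreal t \<and> 0 < X t \<omega>} \<subseteq> N"
proof -
  interpret prob_space "P x" by (rule prob_space_P[OF x])
  define grid where "grid m k = t * real k / real (Suc m)" for m k
  define B where "B \<epsilon> m = {\<omega> \<in> space M. \<exists>k<Suc m. X (grid m k) \<omega> \<le> \<epsilon>}" for \<epsilon> m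
  define D where "D \<delta> \<epsilon> m = {\<omega> \<in> B \<epsilon> m. X t \<omega> \<in> {\<delta><..}}" for \<delta> \<epsilon> m
  \<comment> \<open>A lower limit of events: the grids are not nested in general, but the
    intersections increase with \<open>n\<close>, so the uniform bound on \<open>D\<close> passes to
    \<open>E\<close>.\<close>
  define E where "E \<delta> \<epsilon> = (\<Union>n. \<Inter>m\<in>{n..}. D \<delta> \<epsilon> m)" for \<delta> \<epsilon>
  define N where "N = (\<Union>i. \<Inter>j. E (1 / real (Suc i)) (1 / real (Suc j)))"
  have grid0: "0 \<le> grid m k" for m k using t by (simp add: grid_def)
  have D: "D \<delta> \<epsilon> m \<in> sets (P x)" for \<delta> \<epsilon> m
  proof -
    have "D \<delta> \<epsilon> m = (\<Union>k<Suc m. {\<omega> \<in> space M. X (grid m k) \<omega> \<in> {..\<epsilon>}}) \<inter> {\<omega> \<in> space M. X t \<omega> \<in> {\<delta><..}}"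
      by (auto simp: D_def B_def)
    moreover have "{\<omega> \<in> space M. X t \<omega> \<in> {\<delta><..}} \<in> sets (P x)"
      using x t by (intro sets_P_Collect) auto
    moreover have "(\<Union>k<Suc m. {\<omega> \<in> space M. X (grid m k) \<omega> \<in> {..\<epsilon>}}) \<in> sets (P x)"
      using x grid0 by (intro sets.finite_UN sets_P_Collect) auto
    ultimately show ?thesis by simp
  qed
  have D_le: "measure (P x) (D \<delta> \<epsilon> m) \<le> \<epsilon> / (1 - exp (- \<delta>))" if "0 < \<epsilon>" "0 < \<delta>" for \<delta> \<epsilon> m
  proof -
    have "measure (P x) (D \<delta> \<epsilon> m) \<le> \<epsilon> / (1 - exp (- \<delta>)) * measure (P x) (B \<epsilon> m)"
      unfolding D_def B_def
    proof (rule revival_le[OF x that])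
      show "mono (grid m)"
        unfolding grid_def using t by (intro monoI divide_right_mono mult_left_mono) auto
      show "grid m k \<le> t" if "k < Suc m" for k
      proof -
        have "t * real k \<le> t * real (Suc m)" using t that by (intro mult_left_mono) auto
        then show ?thesis by (simp add: grid_def pos_divide_le_eq del: of_nat_Suc)
      qed
    qed (rule grid0)
    also have "\<dots> \<le> \<epsilon> / (1 - exp (- \<delta>)) * 1"
      using that by (intro mult_left_mono) auto
    finally show ?thesis by simp
  qed
  have E: "E \<delta> \<epsilon> \<in> sets (P x)" for \<delta> \<epsilon>
    unfolding E_def using D by (intro sets.countable_UN sets.countable_INT') auto
  have E_le: "measure (P x) (E \<delta> \<epsilon>) \<le> \<epsilon> / (1 - exp (- \<delta>))" if "0 < \<epsilon>" "0 < \<delta>" for \<delta> \<epsilon>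
  proof (rule LIMSEQ_le_const2)
    show "(\<lambda>n. measure (P x) (\<Inter>m\<in>{n..}. D \<delta> \<epsilon> m)) \<longlonglongrightarrow> measure (P x) (E \<delta> \<epsilon>)"
      unfolding E_def using D
      by (intro finite_Lim_measure_incseq) (auto simp: incseq_def intro!: sets.countable_INT')
    have "measure (P x) (\<Inter>m\<in>{n..}. D \<delta> \<epsilon> m) \<le> measure (P x) (D \<delta> \<epsilon> n)" for n
      using D by (intro finite_measure_mono) auto
    then show "\<exists>N. \<forall>n\<ge>N. measure (P x) (\<Inter>m\<in>{n..}. D \<delta> \<epsilon> m) \<le> \<epsilon> / (1 - exp (- \<delta>))"
      using D_le[OF that] order_trans by blast
  qed
  \<comment> \<open>With \<delta> fixed, the bound
    \<open>\<epsilon> / (1 - exp (- \<delta>))\<close> vanishes along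
    \<open>\<epsilon> = 1 / Suc j\<close>.\<close>
  have "(\<Inter>j. E \<delta> (1 / real (Suc j))) \<in> null_sets (P x)" if "0 < \<delta>" for \<delta>
  proof -
    have "measure (P x) (\<Inter>j. E \<delta> (1 / real (Suc j))) \<le> 0"
    proof (rule LIMSEQ_le_const)
      have "(\<lambda>j. 1 / (1 - exp (- \<delta>)) * (1 / real (Suc j))) \<longlonglongrightarrow> 1 / (1 - exp (- \<delta>)) * 0"
        using LIMSEQ_inverse_real_of_nat by (intro tendsto_intros) (simp add: inverse_eq_divide)
      then show "(\<lambda>j. 1 / real (Suc j) / (1 - exp (- \<delta>))) \<longlonglongrightarrow> 0" by (simp add: mult.commute)
      have "measure (P x) (\<Inter>j. E \<delta> (1 / real (Suc j))) \<le> 1 / real (Suc j) / (1 - exp (- \<delta>))" for j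
      proof -
        have "measure (P x) (\<Inter>j. E \<delta> (1 / real (Suc j))) \<le> measure (P x) (E \<delta> (1 / real (Suc j)))"
          using E by (intro finite_measure_mono) auto
        also have "\<dots> \<le> 1 / real (Suc j) / (1 - exp (- \<delta>))" using that by (intro E_le) auto
        finally show ?thesis .
      qed
      then show "\<exists>N. \<forall>n\<ge>N. measure (P x) (\<Inter>j. E \<delta> (1 / real (Suc j)))
          \<le> 1 / real (Suc n) / (1 - exp (- \<delta>))" by blast
    qed
    then have "measure (P x) (\<Inter>j. E \<delta> (1 / real (Suc j))) = 0"
      by (intro antisym) auto
    then show ?thesis
      using E by (intro null_setsI) (auto simp: emeasure_eq_measure)
  qed
  then have "N \<in> null_sets (P x)" unfolding N_def by (intro null_sets_UN) auto
  moreover have "{\<omega> \<in> space M. extinction_time X \<omega> \<le> ennreal t \<and> 0 < X t \<omega>} \<subseteq> N"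
  proof
    fix \<omega> assume "\<omega> \<in> {\<omega> \<in> space M. extinction_time X \<omega> \<le> ennreal t \<and> 0 < X t \<omega>}"
    then have \<omega>: "\<omega> \<in> space M" "extinction_time X \<omega> \<le> ennreal t" "0 < X t \<omega>" by auto
    obtain i where i: "1 / real (Suc i) < X t \<omega>" using nat_approx_posE[OF \<omega>(3)] .
    obtain r where r: "0 \<le> r" "r < t" "X r \<omega> = 0"
      using hits_zero[OF \<omega>] t by auto
    have "\<omega> \<in> E (1 / real (Suc i)) \<epsilon>" if "0 < \<epsilon>" for \<epsilon>
    proof -
      have "((\<lambda>s. X s \<omega>) \<longlongrightarrow> X r \<omega>) (at_right r)"
        using X_right_continuous[OF r(1) \<omega>(1)] by (simp add: continuous_within)
      then have "\<forall>\<^sub>F s in at_right r. X s \<omega> < \<epsilon>"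
        by (rule order_tendstoD) (use r that in simp)
      then obtain b where b: "r < b" "\<And>s. r < s \<Longrightarrow> s < b \<Longrightarrow> X s \<omega> < \<epsilon>"
        by (auto simp: eventually_at_right_field)
      \<comment> \<open>The length of the interval after \<open>r\<close> on which the path is below
        \<epsilon> and time is before \<open>t\<close>; a mesh finer than this puts a grid point
        inside.\<close>
      define d where "d = min b t - r"
      have d: "0 < d" using b r by (auto simp: d_def)
      obtain n where n: "1 / real (Suc n) < d / t" using nat_approx_posE[of "d / t"] d t by auto
      have "\<omega> \<in> D (1 / real (Suc i)) \<epsilon> m" if m: "n \<le> m" for m
      proof -
        have "1 / real (Suc m) \<le> 1 / real (Suc n)" using m by (intro divide_left_mono) auto
        then have "t * (1 / real (Suc m)) < t * (d / t)"
          using n t by (intro mult_strict_left_mono) auto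
        define c where "c = real (Suc m)"
        have c: "0 < c" by (simp add: c_def)
        have grid: "grid m k = t * real k / c" for k by (simp add: grid_def c_def)
        have tm: "t / c < d"
          using \<open>t * (1 / real (Suc m)) < t * (d / t)\<close> t by (simp add: c_def del: of_nat_Suc)
        \<comment> \<open>The index of the first grid point strictly after \<open>r\<close>.\<close>
        define k where "k = nat \<lfloor>r * c / t\<rfloor> + 1"
        have rm: "0 \<le> r * c / t" using r t c by simp
        have k: "r * c / t < real k" "real k \<le> r * c / t + 1"
          unfolding k_def using rm by linarith+
        have "r < grid m k"
          using k(1) t c by (simp add: grid field_simps)
        moreover have "t * real k \<le> r * c + t"
          using mult_left_mono[OF k(2), of t] t by (simp add: distrib_left)
        then have "grid m k \<le> r + t / c" using c by (simp add: grid field_simps)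
        then have lt: "grid m k < min b t" using tm unfolding d_def by linarith
        ultimately have "X (grid m k) \<omega> < \<epsilon>" using b(2) by simp
        moreover have "k < Suc m"
        proof -
          have "t * real k < t * c"
            using lt c by (simp add: grid pos_divide_less_eq)
          then show ?thesis using t by (simp add: c_def del: of_nat_Suc)
        qed
        ultimately show ?thesis using \<omega> i unfolding D_def B_def
          by (auto intro!: exI[of _ k] less_imp_le)
      qed
      then show ?thesis unfolding E_def by auto
    qed
    then show "\<omega> \<in> N" unfolding N_def by (intro UN_I[of i] INT_I) auto
  qed
  ultimately show ?thesis by (rule that)
qed

text \<open>Survival implies a positive value outright, and the converse fails only inside the null
  set of \<open>revival_null\<close>. The free condition \<open>Q\<close> lets one identity serve
  both numerator and denominator of the conditional probability.\<close>

lemma measure_completion_survival: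
  assumes x: "0 < x" and t: "0 < t" and Q: "{\<omega> \<in> space M. Q \<omega> \<and> 0 < X t \<omega>} \<in> sets (P x)"
  shows "\<P>(\<omega> in completion (P x). Q \<omega> \<and> ennreal t < extinction_time X \<omega>)
    = measure (P x) {\<omega> \<in> space M. Q \<omega> \<and> 0 < X t \<omega>}"
proof -
  obtain N where N: "N \<in> null_sets (P x)"
    "{\<omega> \<in> space M. extinction_time X \<omega> \<le> ennreal t \<and> 0 < X t \<omega>} \<subseteq> N"
    using revival_null[OF x t] .
  define R where "R = {\<omega> \<in> space M. Q \<omega> \<and> 0 < X t \<omega>}"
  define S where "S = {\<omega> \<in> space M. Q \<omega> \<and> ennreal t < extinction_time X \<omega>}"
  define Z where "Z = {\<omega> \<in> space M. Q \<omega> \<and> 0 < X t \<omega> \<and> extinction_time X \<omega> \<le> ennreal t}"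
  have "Z \<in> null_sets (completion (P x))"
    unfolding null_sets_completion_iff2 using N by (auto simp: Z_def)
  moreover have "0 < X t \<omega>" if "\<omega> \<in> space M" "ennreal t < extinction_time X \<omega>" for \<omega>
    using extinction_time_le[of t \<omega>] X_nonneg[of t \<omega>] t that
    by (metis leD less_eq_real_def)
  then have "S = R - Z"
    unfolding S_def R_def Z_def by (auto simp: not_le)
  moreover have "R \<in> sets (completion (P x))" using Q unfolding R_def by (rule sets_completionI_sets)
  ultimately have "measure (completion (P x)) S = measure (completion (P x)) R"
    using \<open>S = R - Z\<close> by (simp add: measure_Diff_null_set)
  then show ?thesis using Q x by (simp add: R_def S_def space_P)
qed

section \<open>Extinction probabilities and the conditional limit\<close>

text \<open>As \<open>l\<close> grows, \<open>exp (- l * X t \<omega>)\<close> tends to the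
  indicator of extinction, dominated by 1, while the cumulant tends to
  \<open>tail_inv t\<close>.\<close>

lemma measure_extinct:
  assumes x: "0 < x" and t: "0 < t"
  shows "measure (P x) {\<omega> \<in> space M. X t \<omega> = 0} = exp (- x * tail_inv t)"
proof -
  interpret prob_space "P x" by (rule prob_space_P[OF x])
  have [measurable]: "X t \<in> borel_measurable (P x)" using x t by (intro measurable_P) auto
  define A where "A = {\<omega> \<in> space (P x). X t \<omega> = 0}"
  have A [measurable]: "A \<in> sets (P x)" unfolding A_def by measurable
  \<comment> \<open>\<open>Suc n\<close> keeps the Laplace parameter positive from the first term
    on.\<close>
  have "(\<lambda>n. \<integral>\<omega>. exp (- real (Suc n) * X t \<omega>) \<partial>P x) \<longlonglongrightarrow> (\<integral>\<omega>. indicator A \<omega> \<partial>P x)"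
  proof (rule integral_dominated_convergence[where w = "\<lambda>_. 1"])
    show "AE \<omega> in P x. (\<lambda>n. exp (- real (Suc n) * X t \<omega>)) \<longlonglongrightarrow> indicator A \<omega>"
    proof (rule AE_I2)
      fix \<omega> assume \<omega>: "\<omega> \<in> space (P x)"
      then have X0: "0 \<le> X t \<omega>" using X_nonneg x t by (simp add: space_P)
      show "(\<lambda>n. exp (- real (Suc n) * X t \<omega>)) \<longlonglongrightarrow> indicator A \<omega>"
      proof (cases "X t \<omega> = 0")
        case True
        then show ?thesis using \<omega> by (simp add: A_def)
      next
        case False
        then have "(\<lambda>n. exp (- X t \<omega>) ^ n) \<longlonglongrightarrow> 0"
          using X0 by (intro LIMSEQ_power_zero) simp
        then have "(\<lambda>n. exp (- X t \<omega>) ^ Suc n) \<longlonglongrightarrow> 0" by (rule LIMSEQ_Suc)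
        moreover have pow: "exp (- X t \<omega>) ^ Suc n = exp (- real (Suc n) * X t \<omega>)" for n
          by (simp add: exp_of_nat_mult[symmetric] del: of_nat_Suc power_Suc)
        moreover have "indicator A \<omega> = (0 :: real)" using False by (simp add: A_def)
        ultimately show ?thesis by (simp only: pow)
      qed
    qed
    show "AE \<omega> in P x. norm (exp (- real (Suc n) * X t \<omega>)) \<le> 1" for n
      using X_nonneg x t by (intro AE_I2) (auto simp: space_P simp del: of_nat_Suc)
  qed auto
  then have "(\<lambda>n. exp (- x * tail_inv (t + tail (real (Suc n))))) \<longlonglongrightarrow> measure (P x) A"
    using laplace_transform[OF x _ less_imp_le[OF t]] A by (simp del: of_nat_Suc)
  moreover have "(\<lambda>n. exp (- x * tail_inv (t + tail (real (Suc n))))) \<longlonglongrightarrow> exp (- x * tail_inv t)"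
    by (intro tendsto_intros filterlim_compose[OF tail_inv_add_tail_tendsto[OF t]]
        filterlim_compose[OF filterlim_real_sequentially filterlim_Suc])
  ultimately have "measure (P x) A = exp (- x * tail_inv t)" by (rule LIMSEQ_unique)
  then show ?thesis using x by (simp add: A_def space_P)
qed

lemma measure_alive:
  assumes x: "0 < x" and t: "0 < t"
  shows "measure (P x) {\<omega> \<in> space M. 0 < X t \<omega>} = 1 - exp (- x * tail_inv t)"
proof -
  interpret prob_space "P x" by (rule prob_space_P[OF x])
  have "{\<omega> \<in> space M. 0 < X t \<omega>} = space (P x) - {\<omega> \<in> space M. X t \<omega> \<in> {0}}"
    using X_nonneg[of t] t x by (force simp: space_P order_le_less)
  then show ?thesis
    using measure_extinct[OF x t] prob_compl[OF sets_P_Collect[OF x, of t "{0}"]] t by simp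
qed

lemma sets_alive:
  assumes "0 < x" "0 < t"
  shows "{\<omega> \<in> space M. 0 < X t \<omega>} \<in> sets (P x)"
    and "{\<omega> \<in> space M. X t \<omega> \<le> c \<and> 0 < X t \<omega>} \<in> sets (P x)"
proof -
  show "{\<omega> \<in> space M. 0 < X t \<omega>} \<in> sets (P x)"
    using sets_P_Collect[of x t "{0<..}"] assms by simp
  have "{\<omega> \<in> space M. X t \<omega> \<in> {0<..c}} \<in> sets (P x)"
    using assms by (intro sets_P_Collect) auto
  then show "{\<omega> \<in> space M. X t \<omega> \<le> c \<and> 0 < X t \<omega>} \<in> sets (P x)"
    by (simp add: conj_commute)
qed

lemma measure_completion_alive:
  assumes x: "0 < x" and t: "0 < t"
  shows "\<P>(\<omega> in completion (P x). ennreal t < extinction_time X \<omega>) = 1 - exp (- x * tail_inv t)"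
proof -
  have "{\<omega> \<in> space M. True \<and> 0 < X t \<omega>} \<in> sets (P x)" using sets_alive(1)[OF x t] by simp
  from measure_completion_survival[OF x t this] measure_alive[OF x t] show ?thesis
    by (simp only: simp_thms)
qed

lemma survival_eq: "0 < t \<Longrightarrow> survival P X t = 1 - exp (- tail_inv t)"
  unfolding survival_def by (subst measure_completion_alive) auto

text \<open>The exponential equals 1 where the process is extinct, so restricting to survival
  subtracts exactly the extinction probability.\<close>

lemma laplace_alive:
  assumes x: "0 < x" and t: "0 < t" and l: "0 < l"
  shows "(\<integral>\<omega>. exp (- l * X t \<omega>) * indicator {\<omega> \<in> space M. 0 < X t \<omega>} \<omega> \<partial>P x)
    = exp (- x * tail_inv (t + tail l)) - exp (- x * tail_inv t)"
proof -
  interpret prob_space "P x" by (rule prob_space_P[OF x])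
  have Z: "{\<omega> \<in> space M. X t \<omega> = 0} \<in> sets (P x)"
    using sets_P_Collect[of x t "{0}"] x t by simp
  have "(\<integral>\<omega>. exp (- l * X t \<omega>) * indicator {\<omega> \<in> space M. 0 < X t \<omega>} \<omega> \<partial>P x)
      = (\<integral>\<omega>. exp (- l * X t \<omega>) - indicator {\<omega> \<in> space M. X t \<omega> = 0} \<omega> \<partial>P x)"
  proof (rule Bochner_Integration.integral_cong[OF refl])
    fix \<omega> assume "\<omega> \<in> space (P x)"
    then have \<omega>: "\<omega> \<in> space M" using x by (simp add: space_P)
    with X_nonneg[of t \<omega>] t have "0 \<le> X t \<omega>" by simp
    then show "exp (- l * X t \<omega>) * indicator {\<omega> \<in> space M. 0 < X t \<omega>} \<omega>
        = exp (- l * X t \<omega>) - indicator {\<omega> \<in> space M. X t \<omega> = 0} \<omega>"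
      using \<omega> by (cases "X t \<omega> = 0") simp_all
  qed
  also have "\<dots> = (\<integral>\<omega>. exp (- l * X t \<omega>) \<partial>P x)
      - (\<integral>\<omega>. indicator {\<omega> \<in> space M. X t \<omega> = 0} \<omega> \<partial>P x)"
    using l t Z
    by (intro Bochner_Integration.integral_diff integrable_exp x integrable_real_indicator)
      (simp_all add: emeasure_eq_measure)
  also have "(\<integral>\<omega>. indicator {\<omega> \<in> space M. X t \<omega> = 0} \<omega> \<partial>P x)
      = measure (P x) {\<omega> \<in> space M. X t \<omega> = 0}"
    using Z by simp
  finally show ?thesis using laplace_transform[OF x l less_imp_le[OF t]] measure_extinct[OF x t] by simp
qed

section \<open>Laplace transform and distribution function conditional on survival\<close>

definition cond_laplace :: "real \<Rightarrow> real \<Rightarrow> real \<Rightarrow> real" where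
  "cond_laplace x t l = (exp (- x * tail_inv (t + tail l)) - exp (- x * tail_inv t))
     / (1 - exp (- x * tail_inv t))"

text \<open>The level is written \<open>1 / p\<close>, so that \<open>p\<close> lives on the same
  scale as the Laplace parameter \<open>l\<close> and the comparisons below depend only on
  \<open>l / p\<close>.\<close>

definition cond_distr :: "real \<Rightarrow> real \<Rightarrow> real \<Rightarrow> real" where
  "cond_distr x t p = measure (P x) {\<omega> \<in> space M. X t \<omega> \<le> 1 / p \<and> 0 < X t \<omega>}
     / (1 - exp (- x * tail_inv t))"

context
  fixes x t p l :: real
  assumes x: "0 < x" and t: "0 < t" and p: "0 < p" and l: "0 < l"
begin

lemma alive_pos: "0 < 1 - exp (- x * tail_inv t)"
  using x tail_inv(1)[OF t] by simp

lemma integrable_alive: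
  "integrable (P x) (\<lambda>\<omega>. exp (- l * X t \<omega>) * indicator {\<omega> \<in> space M. 0 < X t \<omega>} \<omega>)"
  using integrable_real_mult_indicator[OF sets_alive(1)[OF x t] integrable_exp[OF x, of l t]] l t by simp

lemma integrable_indicator_alive:
  assumes "A \<in> sets (P x)"
  shows "integrable (P x) (indicator A :: _ \<Rightarrow> real)"
proof -
  interpret prob_space "P x" by (rule prob_space_P[OF x])
  show ?thesis using assms by (intro integrable_real_indicator) (auto simp: emeasure_eq_measure)
qed

text \<open>Chernoff's bound: \<open>exp (l / p) * exp (- l * X t \<omega>)\<close> is at least 1
  below the level. It is sharp when \<open>l / p\<close> is small.\<close>

lemma cond_distr_le: "cond_distr x t p \<le> exp (l / p) * cond_laplace x t l"
proof -
  have "measure (P x) {\<omega> \<in> space M. X t \<omega> \<le> 1 / p \<and> 0 < X t \<omega>}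
      = (\<integral>\<omega>. indicator {\<omega> \<in> space M. X t \<omega> \<le> 1 / p \<and> 0 < X t \<omega>} \<omega> \<partial>P x)"
    using sets_alive(2)[OF x t] by simp
  also have "\<dots> \<le> (\<integral>\<omega>. exp (l / p) * (exp (- l * X t \<omega>) * indicator {\<omega> \<in> space M. 0 < X t \<omega>} \<omega>) \<partial>P x)"
  proof (rule integral_mono)
    fix \<omega>
    have "1 \<le> exp (l / p) * exp (- l * X t \<omega>)" if "X t \<omega> \<le> 1 / p"
      using mult_left_mono[OF that, of l] l by (simp add: exp_add[symmetric])
    then show "indicator {\<omega> \<in> space M. X t \<omega> \<le> 1 / p \<and> 0 < X t \<omega>} \<omega>
        \<le> exp (l / p) * (exp (- l * X t \<omega>) * indicator {\<omega> \<in> space M. 0 < X t \<omega>} \<omega>)"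
      by (auto simp: indicator_def)
  qed (intro integrable_indicator_alive sets_alive x t integrable_mult_right integrable_alive)+
  also have "\<dots> = exp (l / p) * (exp (- x * tail_inv (t + tail l)) - exp (- x * tail_inv t))"
    using laplace_alive[OF x t l] by simp
  finally show ?thesis
    unfolding cond_distr_def cond_laplace_def
    using alive_pos by (simp add: divide_right_mono)
qed

text \<open>The exponential is at most 1 below the level and at most \<open>exp (- (l / p))\<close>
  above it. This is sharp when \<open>l / p\<close> is large.\<close>

lemma cond_distr_ge: "cond_laplace x t l - exp (- (l / p)) \<le> cond_distr x t p"
proof -
  have "exp (- x * tail_inv (t + tail l)) - exp (- x * tail_inv t)
      - exp (- (l / p)) * (1 - exp (- x * tail_inv t))
      = (\<integral>\<omega>. exp (- l * X t \<omega>) * indicator {\<omega> \<in> space M. 0 < X t \<omega>} \<omega>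
          - exp (- (l / p)) * indicator {\<omega> \<in> space M. 0 < X t \<omega>} \<omega> \<partial>P x)"
    using laplace_alive[OF x t l] measure_alive[OF x t] sets_alive(1)[OF x t]
    by (subst Bochner_Integration.integral_diff)
      (auto intro!: integrable_alive[simplified] integrable_mult_right integrable_indicator_alive)
  also have "\<dots> \<le> (\<integral>\<omega>. indicator {\<omega> \<in> space M. X t \<omega> \<le> 1 / p \<and> 0 < X t \<omega>} \<omega> \<partial>P x)"
  proof (rule integral_mono)
    fix \<omega> assume "\<omega> \<in> space (P x)"
    then have "0 \<le> X t \<omega>" using X_nonneg t x by (simp add: space_P)
    then have 1: "exp (- (l * X t \<omega>)) \<le> 1" using l by simp
    have 2: "exp (- (l * X t \<omega>)) \<le> exp (- (l / p))" if "\<not> X t \<omega> \<le> 1 / p"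
      using mult_left_mono[of "1 / p" "X t \<omega>" l] that l by simp
    have 3: "exp (- (l * X t \<omega>)) - exp (- (l / p)) \<le> 1"
      using 1 exp_gt_zero[of "- (l / p)"] by linarith
    show "exp (- l * X t \<omega>) * indicator {\<omega> \<in> space M. 0 < X t \<omega>} \<omega>
          - exp (- (l / p)) * indicator {\<omega> \<in> space M. 0 < X t \<omega>} \<omega>
        \<le> indicator {\<omega> \<in> space M. X t \<omega> \<le> 1 / p \<and> 0 < X t \<omega>} \<omega>"
      using 2 3 by (auto simp: indicator_def)
  qed (intro integrable_indicator_alive sets_alive x t integrable_mult_right integrable_alive
      Bochner_Integration.integrable_diff)+
  also have "\<dots> = measure (P x) {\<omega> \<in> space M. X t \<omega> \<le> 1 / p \<and> 0 < X t \<omega>}"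
    using sets_alive(2)[OF x t] by simp
  finally have "(exp (- x * tail_inv (t + tail l)) - exp (- x * tail_inv t)
      - exp (- (l / p)) * (1 - exp (- x * tail_inv t))) / (1 - exp (- x * tail_inv t))
      \<le> cond_distr x t p"
    unfolding cond_distr_def using alive_pos by (intro divide_right_mono) auto
  moreover have "(a - b * c) / c = a / c - b" if "0 < c" for a b c :: real
    using that by (simp add: diff_divide_distrib)
  ultimately show ?thesis
    using alive_pos by (simp only: cond_laplace_def)
qed

end

section \<open>Large-time asymptotics and the conditional limit\<close>

lemma survival_bounds: "\<forall>\<^sub>F t in at_top. tail_inv t / 2 \<le> survival P X t \<and> survival P X t \<le> tail_inv t"
proof -
  have "((\<lambda>t. (1 - exp (- tail_inv t)) / tail_inv t) \<longlongrightarrow> 1) at_top"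
    by (rule filterlim_compose[OF one_minus_exp_over_self tail_inv_at_top])
  \<comment> \<open>Any constant below 1 would do; 1/2 is the one fixed in the squeeze lemmas
    \<open>slope_ratio_tendsto\<close> and \<open>tail_ratio_tendsto\<close>.\<close>
  then have "\<forall>\<^sub>F t in at_top. 1 / 2 < (1 - exp (- tail_inv t)) / tail_inv t"
    by (rule order_tendstoD) simp
  with eventually_gt_at_top[of 0] show ?thesis
  proof eventually_elim
    case (elim t)
    then show ?case
      using tail_inv(1)[of t] exp_ge_add_one_self[of "- tail_inv t"]
      by (simp add: survival_eq pos_less_divide_eq)
  qed
qed

lemma survival_pos: "0 < t \<Longrightarrow> 0 < survival P X t"
  using tail_inv(1)[of t] by (simp add: survival_eq)

lemma survival_tendsto: "filterlim (survival P X) (at_right 0) at_top"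
  unfolding filterlim_at
proof
  have "(tail_inv \<longlongrightarrow> 0) at_top" using tail_inv_at_top by (simp add: filterlim_at)
  then show "(survival P X \<longlongrightarrow> 0) at_top"
  proof (rule tendsto_sandwich[OF _ _ tendsto_const, rotated 2])
    show "\<forall>\<^sub>F t in at_top. 0 \<le> survival P X t"
      by (rule eventually_mono[OF eventually_gt_at_top[of 0]]) (rule less_imp_le[OF survival_pos])
    show "\<forall>\<^sub>F t in at_top. survival P X t \<le> tail_inv t"
      by (rule eventually_mono[OF survival_bounds]) simp
  qed
  show "\<forall>\<^sub>F t in at_top. survival P X t \<in> {0<..} \<and> survival P X t \<noteq> 0"
    by (rule eventually_mono[OF eventually_gt_at_top[of 0]]) (auto dest: survival_pos)
qed

text \<open>Since \<open>tail (tail_inv t) = t\<close>, only the replacement of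
  \<open>tail_inv t\<close> by the survival probability is at stake, and
  \<open>tail_ratio_tendsto\<close> covers it.\<close>

lemma V_survival_equiv: "(\<lambda>t. V_of \<psi> (1 / survival P X t)) \<sim>[at_top] (\<lambda>t. t)"
proof (rule asymp_equivI')
  have "((\<lambda>t. tail (survival P X t) / tail (tail_inv t)) \<longlongrightarrow> 1) at_top"
    by (rule tail_ratio_tendsto[OF tail_inv_at_top survival_bounds])
  moreover have "\<forall>\<^sub>F t in at_top. tail (survival P X t) / tail (tail_inv t)
      = V_of \<psi> (1 / survival P X t) / t"
    using eventually_gt_at_top[of 0]
  proof eventually_elim
    case (elim t)
    then show ?case using survival_pos[OF elim] by (simp add: tail_inv V_of_eq)
  qed
  ultimately show "((\<lambda>t. V_of \<psi> (1 / survival P X t) / t) \<longlongrightarrow> 1) at_top"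
    by (rule Lim_transform_eventually)
qed

text \<open>With this scale, \<open>tail_inv (y * time_scale t)\<close> is the
  \<open>q\<^sub>y\<close> of the overview.\<close>

definition time_scale :: "real \<Rightarrow> real" where
  "time_scale t = 1 / slope (survival P X t)"

lemma time_scale_pos: "0 < t \<Longrightarrow> 0 < time_scale t"
  using slope_pos[OF survival_pos[of t]] by (simp add: time_scale_def)

lemma time_scale_at_top: "filterlim time_scale at_top at_top"
proof -
  have "((\<lambda>t. slope (survival P X t)) \<longlongrightarrow> 0) at_top"
    by (rule filterlim_compose[OF slope_tendsto_0 survival_tendsto])
  moreover have "\<forall>\<^sub>F t in at_top. 0 < slope (survival P X t)"
    using eventually_gt_at_top[of 0] by eventually_elim (intro slope_pos survival_pos)
  ultimately have "filterlim (\<lambda>t. inverse (slope (survival P X t))) at_top at_top"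
    by (rule filterlim_inverse_at_top)
  then show ?thesis unfolding time_scale_def inverse_eq_divide .
qed

text \<open>Here \<open>tail (u t)\<close> exceeds \<open>t\<close> by exactly
  \<open>y * time_scale t\<close>, so \<open>cumulant_ratio_tendsto\<close> gives the limit
  \<open>exp (- y)\<close> for \<open>u t / tail_inv t\<close>. After linearising the exponentials
  the starting point \<open>x\<close> cancels.\<close>

lemma cond_laplace_tendsto:
  assumes x: "0 < x" and y: "0 < y"
  shows "((\<lambda>t. cond_laplace x t (tail_inv (y * time_scale t))) \<longlongrightarrow> 1 - exp (- y)) at_top"
proof -
  define u where "u t = tail_inv (t + y * time_scale t)" for t
  have pos: "\<forall>\<^sub>F t in at_top. 0 < t \<and> 0 < tail_inv t \<and> 0 < u t \<and> 0 < y * time_scale t"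
    using eventually_gt_at_top[of 0]
  proof eventually_elim
    case (elim t)
    then have "0 < y * time_scale t" using y time_scale_pos by simp
    then show ?case using elim by (simp add: u_def tail_inv)
  qed
  have "filterlim (\<lambda>t. t + y * time_scale t) at_top at_top"
    by (rule filterlim_at_top_add_at_top[OF filterlim_ident
        filterlim_tendsto_pos_mult_at_top[OF tendsto_const y time_scale_at_top]])
  then have u0: "filterlim u (at_right 0) at_top"
    unfolding u_def by (rule filterlim_compose[OF tail_inv_at_top])
  have ratio: "((\<lambda>t. u t / tail_inv t) \<longlongrightarrow> exp (- y)) at_top"
  proof (rule cumulant_ratio_tendsto[OF tail_inv_at_top _ y])
    show "\<forall>\<^sub>F t in at_top. 0 < u t" by (rule eventually_mono[OF pos]) simp
    have "((\<lambda>t. y / (slope (survival P X t) / slope (tail_inv t))) \<longlongrightarrow> y / 1) at_top"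
      by (rule tendsto_divide[OF tendsto_const
          slope_ratio_tendsto[OF tail_inv_at_top survival_bounds] one_neq_zero])
    moreover have "\<forall>\<^sub>F t in at_top. y / (slope (survival P X t) / slope (tail_inv t))
        = (tail (u t) - tail (tail_inv t)) * slope (tail_inv t)"
      using pos
    proof eventually_elim
      case (elim t)
      then have "tail (u t) - tail (tail_inv t) = y * time_scale t" by (simp add: u_def tail_inv)
      then show ?case by (simp add: time_scale_def)
    qed
    ultimately have "((\<lambda>t. (tail (u t) - tail (tail_inv t)) * slope (tail_inv t)) \<longlongrightarrow> y / 1) at_top"
      by (rule Lim_transform_eventually)
    then show "((\<lambda>t. (tail (u t) - tail (tail_inv t)) * slope (tail_inv t)) \<longlongrightarrow> y) at_top"
      by simp
  qed
  have lin: "((\<lambda>t. (1 - exp (- (x * w t))) / (x * w t)) \<longlongrightarrow> 1) at_top"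
    if "filterlim w (at_right 0) at_top" for w
  proof (rule filterlim_compose[OF one_minus_exp_over_self])
    show "filterlim (\<lambda>t. x * w t) (at_right 0) at_top"
      by (rule filterlim_times_pos[OF that x]) simp
  qed
  \<comment> \<open>The conditional transform is 1 minus a quotient of survival-type terms; it is
    written so that each factor has a known limit.\<close>
  have "((\<lambda>t. 1 - (1 - exp (- (x * u t))) / (x * u t) / ((1 - exp (- (x * tail_inv t))) / (x * tail_inv t))
      * (u t / tail_inv t)) \<longlongrightarrow> 1 - 1 / 1 * exp (- y)) at_top"
    by (rule tendsto_diff[OF tendsto_const tendsto_mult[OF tendsto_divide[OF
          lin[OF u0] lin[OF tail_inv_at_top] one_neq_zero] ratio]])
  moreover have "\<forall>\<^sub>F t in at_top. 1 - (1 - exp (- (x * u t))) / (x * u t)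
      / ((1 - exp (- (x * tail_inv t))) / (x * tail_inv t)) * (u t / tail_inv t)
      = cond_laplace x t (tail_inv (y * time_scale t))"
    using pos
  proof eventually_elim
    case (elim t)
    have alg: "1 - (1 - U) / (x * a) / ((1 - W) / (x * b)) * (a / b) = (U - W) / (1 - W)"
      if "0 < a" "0 < b" "W < 1" for a b U W :: real
    proof -
      have "(1 - U) / (x * a) / ((1 - W) / (x * b)) * (a / b) = (1 - U) / (1 - W)"
        using that x by simp
      moreover have "1 - (1 - U) / (1 - W) = (U - W) / (1 - W)"
        using that by (simp add: diff_divide_eq_iff)
      ultimately show ?thesis by (simp only:)
    qed
    have "t + tail (tail_inv (y * time_scale t)) = t + y * time_scale t" using elim by (simp add: tail_inv)
    then have "cond_laplace x t (tail_inv (y * time_scale t))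
        = (exp (- (x * u t)) - exp (- (x * tail_inv t))) / (1 - exp (- (x * tail_inv t)))"
      by (simp only: cond_laplace_def u_def mult_minus_left)
    moreover have "exp (- (x * tail_inv t)) < 1" using elim x by simp
    ultimately show ?case using alg[of "u t" "tail_inv t"] elim by (simp only:)
  qed
  ultimately have "((\<lambda>t. cond_laplace x t (tail_inv (y * time_scale t)))
      \<longlongrightarrow> 1 - 1 / 1 * exp (- y)) at_top"
    by (rule Lim_transform_eventually)
  then show ?thesis by simp
qed

text \<open>Laplace parameters with \<open>z\<close> slightly off \<open>y\<close> are used. For
  \<open>z < y\<close> the ratio \<open>?q z t / ?q y t\<close> tends to infinity and the error in
  \<open>cond_distr_ge\<close> vanishes; for \<open>z > y\<close> it tends to 0 and the factor in
  \<open>cond_distr_le\<close> tends to 1. Continuity of \<open>1 - exp (- z)\<close> closes the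
  gap.\<close>

lemma cond_distr_tendsto:
  assumes x: "0 < x" and y: "0 < y"
  shows "((\<lambda>t. cond_distr x t (tail_inv (y * time_scale t))) \<longlongrightarrow> 1 - exp (- y)) at_top"
proof -
  let ?q = "\<lambda>z t. tail_inv (z * time_scale t)"
  have pos: "\<forall>\<^sub>F t in at_top. 0 < t \<and> 0 < ?q z t" if "0 < z" for z
    using eventually_gt_at_top[of 0]
    by eventually_elim (simp add: that time_scale_pos tail_inv(1))
  have lim: "((\<lambda>z::real. 1 - exp (- z)) \<longlongrightarrow> 1 - exp (- y)) (at y within S)" for S
    by (intro tendsto_intros)
  show ?thesis
  proof (rule order_tendstoI)
    fix a assume "a < 1 - exp (- y)"
    then have "\<forall>\<^sub>F z in at_left y. a < 1 - exp (- z)" by (rule order_tendstoD[OF lim])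
    moreover have "\<forall>\<^sub>F z in at_left y. 0 < z \<and> z < y"
      by (rule eventually_mono[OF eventually_at_left_real[OF y]]) simp
    ultimately have "\<forall>\<^sub>F z in at_left y. a < 1 - exp (- z) \<and> 0 < z \<and> z < y"
      by eventually_elim simp
    then obtain z where z: "a < 1 - exp (- z)" "0 < z" "z < y"
      using eventually_happens'[OF trivial_limit_at_left_real] by blast
    have "((\<lambda>t. ?q y t / ?q z t) \<longlongrightarrow> 0) at_top"
      by (rule tail_inv_ratio_tendsto_0[OF time_scale_at_top z(2,3)])
    moreover have "\<forall>\<^sub>F t in at_top. 0 < ?q y t / ?q z t"
      by (rule eventually_mono[OF eventually_conj[OF pos[OF y] pos[OF z(2)]]]) simp
    ultimately have "filterlim (\<lambda>t. inverse (?q y t / ?q z t)) at_top at_top"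
      by (rule filterlim_inverse_at_top)
    then have "filterlim (\<lambda>t. - (?q z t / ?q y t)) at_bot at_top"
      by (simp add: filterlim_uminus_at_bot)
    then have "((\<lambda>t. exp (- (?q z t / ?q y t))) \<longlongrightarrow> 0) at_top"
      by (rule filterlim_compose[OF exp_at_bot])
    with cond_laplace_tendsto[OF x z(2)]
    have "((\<lambda>t. cond_laplace x t (?q z t) - exp (- (?q z t / ?q y t))) \<longlongrightarrow> 1 - exp (- z) - 0) at_top"
      by (rule tendsto_diff)
    then have "\<forall>\<^sub>F t in at_top. a < cond_laplace x t (?q z t) - exp (- (?q z t / ?q y t))"
      by (rule order_tendstoD) (use z in simp)
    with pos[OF y] pos[OF z(2)] show "\<forall>\<^sub>F t in at_top. a < cond_distr x t (?q y t)"
    proof eventually_elim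
      case (elim t)
      then show ?case using cond_distr_ge[OF x, of t "?q y t" "?q z t"] by linarith
    qed
  next
    fix a assume "1 - exp (- y) < a"
    then have "\<forall>\<^sub>F z in at_right y. 1 - exp (- z) < a" by (rule order_tendstoD[OF lim])
    moreover have "\<forall>\<^sub>F z in at_right y. y < z" by (rule eventually_at_right_less)
    ultimately have "\<forall>\<^sub>F z in at_right y. 1 - exp (- z) < a \<and> y < z"
      by eventually_elim simp
    then obtain z where z: "1 - exp (- z) < a" "y < z"
      using eventually_happens'[OF trivial_limit_at_right_real] by blast
    then have z0: "0 < z" using y by simp
    have "((\<lambda>t. ?q z t / ?q y t) \<longlongrightarrow> 0) at_top"
      by (rule tail_inv_ratio_tendsto_0[OF time_scale_at_top y z(2)])
    then have "((\<lambda>t. exp (?q z t / ?q y t) * cond_laplace x t (?q z t)) \<longlongrightarrow> exp 0 * (1 - exp (- z))) at_top"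
      by (rule tendsto_mult[OF tendsto_exp cond_laplace_tendsto[OF x z0]])
    then have "\<forall>\<^sub>F t in at_top. exp (?q z t / ?q y t) * cond_laplace x t (?q z t) < a"
      by (rule order_tendstoD) (use z in simp)
    with pos[OF y] pos[OF z0] show "\<forall>\<^sub>F t in at_top. cond_distr x t (?q y t) < a"
    proof eventually_elim
      case (elim t)
      then show ?case using cond_distr_le[OF x, of t "?q y t" "?q z t"] by linarith
    qed
  qed
qed

text \<open>While the process is alive, \<open>V_of\<close> can be inverted, and the event becomes
  \<open>X t \<omega> \<le> 1 / tail_inv (y * time_scale t)\<close>, to which
  \<open>cond_distr_tendsto\<close> applies.\<close>

lemma conditional_limit:
  assumes x: "0 < x" and y: "0 \<le> y"
  shows "((\<lambda>t. cond_prob (completion (P x))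
      (\<lambda>\<omega>. slope (survival P X t) * V_of \<psi> (X t \<omega>) \<le> y)
      (\<lambda>\<omega>. ennreal t < extinction_time X \<omega>)) \<longlongrightarrow> 1 - exp (- y)) at_top"
proof -
  let ?Q = "\<lambda>t \<omega>. slope (survival P X t) * V_of \<psi> (X t \<omega>) \<le> y"
  note denom = measure_completion_alive[OF x]
  have Q_iff: "?Q t \<omega> \<longleftrightarrow> tail (1 / X t \<omega>) \<le> y * time_scale t" if "0 < t" "0 < X t \<omega>" for t \<omega>
    using that slope_pos[OF survival_pos[of t]]
    by (simp add: V_of_eq time_scale_def pos_le_divide_eq mult.commute)
  show ?thesis
  proof (cases "y = 0")
    \<comment> \<open>\<open>tail_inv\<close> carries no information at 0, so this case is separate:
      \<open>tail\<close> is positive, hence the event is empty on survival and the limit is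
      0.\<close>
    case True
    have "\<forall>\<^sub>F t in at_top. cond_prob (completion (P x)) (?Q t) (\<lambda>\<omega>. ennreal t < extinction_time X \<omega>) = 0"
      using eventually_gt_at_top[of 0]
    proof eventually_elim
      case (elim t)
      have "\<not> ?Q t \<omega>" if "0 < X t \<omega>" for \<omega>
        using Q_iff[OF elim that] tail_pos[of "1 / X t \<omega>"] True that by simp
      then have empty: "{\<omega> \<in> space M. ?Q t \<omega> \<and> 0 < X t \<omega>} = {}" by blast
      then have "{\<omega> \<in> space M. ?Q t \<omega> \<and> 0 < X t \<omega>} \<in> sets (P x)" by (simp only: sets.empty_sets)
      from measure_completion_survival[OF x elim this]
      have "\<P>(\<omega> in completion (P x). ?Q t \<omega> \<and> ennreal t < extinction_time X \<omega>) = 0"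
        by (simp only: empty measure_empty)
      then show ?case by (simp only: cond_prob_def div_0)
    qed
    then have "((\<lambda>t. cond_prob (completion (P x)) (?Q t) (\<lambda>\<omega>. ennreal t < extinction_time X \<omega>)) \<longlongrightarrow> 0) at_top"
      by (rule tendsto_eventually)
    then show ?thesis using True by simp
  next
    case False
    then have y0: "0 < y" using y by simp
    have "\<forall>\<^sub>F t in at_top. cond_distr x t (tail_inv (y * time_scale t))
        = cond_prob (completion (P x)) (?Q t) (\<lambda>\<omega>. ennreal t < extinction_time X \<omega>)"
      using eventually_gt_at_top[of 0]
    proof eventually_elim
      case (elim t)
      let ?q = "tail_inv (y * time_scale t)"
      have s: "0 < y * time_scale t" using y0 time_scale_pos[OF elim] by simp
      have "?Q t \<omega> \<longleftrightarrow> X t \<omega> \<le> 1 / ?q" if "0 < X t \<omega>" for \<omega>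
      proof -
        have "?Q t \<omega> \<longleftrightarrow> tail (1 / X t \<omega>) \<le> y * time_scale t" by (rule Q_iff[OF elim that])
        also have "\<dots> \<longleftrightarrow> ?q \<le> 1 / X t \<omega>"
          using less_tail_inv_iff[OF s, of "1 / X t \<omega>"] that by (simp only: not_less[symmetric]) simp
        also have "\<dots> \<longleftrightarrow> X t \<omega> \<le> 1 / ?q"
          using that tail_inv(1)[OF s] by (simp add: field_simps)
        finally show ?thesis .
      qed
      then have eq: "{\<omega> \<in> space M. ?Q t \<omega> \<and> 0 < X t \<omega>} = {\<omega> \<in> space M. X t \<omega> \<le> 1 / ?q \<and> 0 < X t \<omega>}"
        by auto
      then have "{\<omega> \<in> space M. ?Q t \<omega> \<and> 0 < X t \<omega>} \<in> sets (P x)"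
        using sets_alive(2)[OF x elim, of "1 / ?q"] by (simp only:)
      from measure_completion_survival[OF x elim this] show ?case
        by (simp only: cond_prob_def cond_distr_def denom[OF elim] eq)
    qed
    with cond_distr_tendsto[OF x y0] show ?thesis by (rule Lim_transform_eventually)
  qed
qed

end

section \<open>From the hypotheses of the theorem to its conclusion\<close>

lemma grey_mechanismI:
  assumes mech: "branching_mechanism \<psi>" and crit: "critical \<psi>"
    and grey: "\<exists>\<theta>>0. (\<integral>\<^sup>+\<xi>\<in>{\<theta>..}. 1 / ennreal (\<psi> \<xi>) \<partial>lborel) < \<infinity>"
    and sv: "slowly_varying L" and L: "\<And>l. 0 < l \<Longrightarrow> \<psi> l = l * L (1 / l)"
  shows "grey_mechanism \<psi>"
proof
  have convex: "convex_on {0..} \<psi>" by (rule convex_on_branching_mechanism[OF mech])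
  have zero: "\<psi> 0 = 0" by (rule branching_mechanism_0[OF mech])
  have L_pos: "0 < L x" if "0 < x" for x using sv that by (simp add: slowly_varying_def)
  show cont: "continuous_on {0<..} \<psi>"
    by (rule convex_on_continuous) (auto intro: convex_on_subset[OF convex])
  show pos: "0 < \<psi> l" if "0 < l" for l using that L L_pos by simp
  show "\<psi> a / a \<le> \<psi> b / b" if "0 < a" "a \<le> b" for a b
    by (rule convex_on_slope_mono[OF convex zero that])
  show "((\<lambda>l. \<psi> l / l) \<longlongrightarrow> 0) (at_right 0)"
    using crit zero by (simp add: critical_def has_field_derivative_iff)
  show "((\<lambda>l. \<psi> (c * l) / (c * l) / (\<psi> l / l)) \<longlongrightarrow> 1) (at_right 0)" if c: "0 < c" for c
  proof -
    \<comment> \<open>At \<open>x = inverse l\<close> the slope at \<open>c * l\<close> is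
      \<open>L (inverse c * x)\<close>, which explains the inverse.\<close>
    have "((\<lambda>x. L (inverse c * x) / L x) \<longlongrightarrow> 1) at_top"
      using sv c by (simp add: slowly_varying_def)
    then have "((\<lambda>l. L (inverse c * inverse l) / L (inverse l)) \<longlongrightarrow> 1) (at_right 0)"
      by (rule filterlim_compose[OF _ filterlim_inverse_at_top_right])
    moreover have "\<forall>\<^sub>F l in at_right 0. L (inverse c * inverse l) / L (inverse l)
        = \<psi> (c * l) / (c * l) / (\<psi> l / l)"
      using eventually_at_right_less[of 0]
      by eventually_elim (use c L in \<open>simp add: inverse_eq_divide\<close>)
    ultimately show ?thesis by (rule Lim_transform_eventually)
  qed
  obtain \<theta> where \<theta>: "0 < \<theta>" "(\<integral>\<^sup>+\<xi>\<in>{\<theta>..}. 1 / ennreal (\<psi> \<xi>) \<partial>lborel) < \<infinity>" using grey by blast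
  have cont': "continuous_on S (\<lambda>\<xi>. 1 / \<psi> \<xi>)" if "S \<subseteq> {0<..}" for S
    using that pos
    by (intro continuous_on_divide continuous_on_const continuous_on_subset[OF cont])
      (force simp: less_imp_neq[symmetric])+
  have "set_integrable lborel {\<theta>..} (\<lambda>\<xi>. 1 / \<psi> \<xi>)"
    unfolding set_integrable_def
  proof (rule integrableI_nonneg)
    have "(\<lambda>\<xi>. indicator {\<theta>..} \<xi> *\<^sub>R (1 / \<psi> \<xi>)) \<in> borel_measurable borel"
      using \<theta> by (intro borel_measurable_continuous_on_indicator cont') auto
    then show "(\<lambda>\<xi>. indicator {\<theta>..} \<xi> *\<^sub>R (1 / \<psi> \<xi>)) \<in> borel_measurable lborel"
      by simp
    show "AE \<xi> in lborel. 0 \<le> indicator {\<theta>..} \<xi> *\<^sub>R (1 / \<psi> \<xi>)"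
      using \<theta> pos by (intro AE_I2) (auto simp: indicator_def less_imp_le)
    have "(\<integral>\<^sup>+\<xi>. ennreal (indicator {\<theta>..} \<xi> *\<^sub>R (1 / \<psi> \<xi>)) \<partial>lborel)
        = (\<integral>\<^sup>+\<xi>\<in>{\<theta>..}. 1 / ennreal (\<psi> \<xi>) \<partial>lborel)"
    proof (rule nn_integral_cong)
      fix \<xi> :: real
      show "ennreal (indicator {\<theta>..} \<xi> *\<^sub>R (1 / \<psi> \<xi>)) = 1 / ennreal (\<psi> \<xi>) * indicator {\<theta>..} \<xi>"
        using \<theta> pos[of \<xi>] divide_ennreal[of 1 "\<psi> \<xi>"] by (auto simp: indicator_def)
    qed
    then show "(\<integral>\<^sup>+\<xi>. ennreal (indicator {\<theta>..} \<xi> *\<^sub>R (1 / \<psi> \<xi>)) \<partial>lborel) < \<infinity>" using \<theta> by simp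
  qed
  then show "set_integrable lborel {l..} (\<lambda>\<xi>. 1 / \<psi> \<xi>)" if "0 < l" for l
  proof -
    assume int: "set_integrable lborel {\<theta>..} (\<lambda>\<xi>. 1 / \<psi> \<xi>)"
    \<comment> \<open>Lowering the limit of integration below \<theta> adds only a compact interval
      on which \<open>1 / \<psi> \<xi>\<close> is continuous.\<close>
    have "set_integrable lborel {l..\<theta>} (\<lambda>\<xi>. 1 / \<psi> \<xi>)"
      using that by (intro borel_integrable_atLeastAtMost' cont') auto
    then have "set_integrable lborel ({l..\<theta>} \<union> {\<theta>..}) (\<lambda>\<xi>. 1 / \<psi> \<xi>)"
      using int by (intro set_integrable_Un) auto
    then show ?thesis by (rule set_integrable_subset) auto
  qed
qed

theorem theorem4:
  fixes M :: "'w measure"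
    and P :: "real \<Rightarrow> 'w measure"
    and X :: "real \<Rightarrow> 'w \<Rightarrow> real"
    and \<psi> L :: "real \<Rightarrow> real"
  assumes "cb_process M P X \<psi>"
    and "critical \<psi>"
    and "\<exists>\<theta>>0. (\<integral>\<^sup>+\<xi>\<in>{\<theta>..}. 1 / ennreal (\<psi> \<xi>) \<partial>lborel) < \<infinity>"
    and "slowly_varying L"
    and "\<And>l. 0 < l \<Longrightarrow> \<psi> l = l * L (1 / l)"
  shows "(\<forall>x>0. V_of \<psi> x = (LINT \<xi>:{0<..<x}|lborel. 1 / (\<xi> * L \<xi>))) \<and>
    (\<lambda>t. V_of \<psi> (1 / survival P X t)) \<sim>[at_top] (\<lambda>t. t) \<and>
    (\<forall>x>0. \<forall>y\<ge>0.
       ((\<lambda>t. cond_prob (completion (P x))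
               (\<lambda>\<omega>. L (1 / survival P X t) * V_of \<psi> (X t \<omega>) \<le> y)
               (\<lambda>\<omega>. ennreal t < extinction_time X \<omega>))
         \<longlongrightarrow> 1 - exp (- y)) at_top)"
proof -
  interpret cb_process M P X \<psi> by fact
  interpret grey_mechanism \<psi>
    by (rule grey_mechanismI[OF mechanism assms(2-5)])
  interpret grey_cb_process M P X \<psi> ..
  have slope_eq: "slope (1 / z) = L z" if "0 < z" for z
    using that assms(5)[of "1 / z"] by (simp add: slope_def)
  have "V_of \<psi> x = (LINT \<xi>:{0<..<x}|lborel. 1 / (\<xi> * L \<xi>))" if "0 < x" for x
  proof -
    have "V_of \<psi> x = (LINT \<xi>:{0<..<x}|lborel. 1 / (\<xi> * slope (1 / \<xi>)))"
      using that by (simp add: V_of_eq tail_substitution)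
    also have "\<dots> = (LINT \<xi>:{0<..<x}|lborel. 1 / (\<xi> * L \<xi>))"
      by (rule set_lebesgue_integral_cong) (auto simp: slope_eq)
    finally show ?thesis .
  qed
  moreover have "((\<lambda>t. cond_prob (completion (P x))
      (\<lambda>\<omega>. L (1 / survival P X t) * V_of \<psi> (X t \<omega>) \<le> y)
      (\<lambda>\<omega>. ennreal t < extinction_time X \<omega>)) \<longlongrightarrow> 1 - exp (- y)) at_top" if "0 < x" "0 \<le> y" for x y
  proof (rule Lim_transform_eventually[OF conditional_limit[OF that]])
    show "\<forall>\<^sub>F t in at_top. cond_prob (completion (P x))
        (\<lambda>\<omega>. slope (survival P X t) * V_of \<psi> (X t \<omega>) \<le> y)
        (\<lambda>\<omega>. ennreal t < extinction_time X \<omega>)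
      = cond_prob (completion (P x)) (\<lambda>\<omega>. L (1 / survival P X t) * V_of \<psi> (X t \<omega>) \<le> y)
        (\<lambda>\<omega>. ennreal t < extinction_time X \<omega>)"
      using eventually_gt_at_top[of 0]
    proof eventually_elim
      case (elim t)
      show ?case using slope_eq[of "1 / survival P X t"] survival_pos[OF elim] by simp
    qed
  qed
  ultimately show ?thesis using V_survival_equiv by blast
qed

end
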